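(* Let $\lambda$ be a partition with Frobenius notation $\lambda=(p_1,\ldots,p_N\mid q_1,\ldots,q_N)$. Let $(z_k)_k$ be complex numbers indexed by the contents $k$ of boxes of $\lambda$, with $\Re(z_k)\ge 1$ for all such $k$ and $\Re(z_{p_i})>1$, $\Re(z_{-q_i})>1$ for all $1\le i\le N$, and let ${\pmb s}=(s_{ij})$ be the filling of $\lambda$ with $s_{ij}=z_{j-i}$. Then $$\zeta_\lambda({\pmb s})=\sum_{m_1,\ldots,m_N\ge 1}(m_1\cdots m_N)^{-z_0}\sum_{\sigma\in\mathfrak{S}_N}\mathrm{sgn}(\sigma)\prod_{k=1}^{N}\zeta^{\bullet,H}_{p_k,p_k}\big((z_1,\ldots,z_{p_k}),m_{\sigma(k)},A_{p_k}\big)\prod_{j=1}^{N}\zeta^{H}_{q_j}\big((z_{-1},\ldots,z_{-q_j}),m_j,A_{q_j}\big),$$ where $\mathfrak{S}_N$ is the symmetric group on $\{1,\dots,N\}$.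
   Context: For a partition $\lambda$ with conjugate $\lambda'$, let $N$ be the number of boxes on the main diagonal; its Frobenius notation is $\lambda=(p_1,\ldots,p_N\mid q_1,\ldots,q_N)$ with $p_i=\lambda_i-i$, $q_i=\lambda'_i-i$. $\mathrm{SSYT}(\lambda)$ is the set of fillings $M=(m_{ij})$ of the Young diagram by positive integers, weakly increasing along rows and strictly increasing down columns; for a filling ${\pmb s}=(s_{ij})$ by complex numbers, $\zeta_\lambda({\pmb s})=\sum_{M\in\mathrm{SSYT}(\lambda)}\prod_{(i,j)\in\lambda}m_{ij}^{-s_{ij}}$. The content of box $(i,j)$ is $j-i$. For $r\ge 0$, $x>0$ and $(w_1,\dots,w_r)\in\mathbb{C}^r$, define $\zeta^{\bullet,H}_{r,r}((w_1,\ldots,w_r),x,A_r)=\sum_{a_1,\ldots,a_r\ge 0}\prod_{j=1}^{r}(x+a_1+\cdots+a_j)^{-w_j}$ and $\zeta^{H}_{r}((w_1,\ldots,w_r),x,A_r)=\sum_{b_1,\ldots,b_r\ge 1}\prod_{j=1}^{r}(x+b_1+\cdots+b_j)^{-w_j}$, both equal to $1$ when $r=0$. (These are Hurwitz-type modified zeta-functions of the root system $A_r$, $\sum\prod_{1\le i<j\le r+1}(x+m_i+\cdots+m_{j-1})^{-s(i,j)}$ with all $m_i\ge 0$, resp. all $m_i\ge1$, specialized to $s(1,j+1)=w_j$ and other $s(i,j)=0$.) *)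

theory Defs
  imports "HOL-Analysis.Analysis" "HOL-Combinatorics.Permutations"
begin

definition is_partition :: "nat list \<Rightarrow> bool" where
  "is_partition lam \<longleftrightarrow> sorted_wrt (\<ge>) lam \<and> (\<forall>x\<in>set lam. 0 < x)"

definition part :: "nat list \<Rightarrow> nat \<Rightarrow> nat" where
  "part lam i = (if 1 \<le> i \<and> i \<le> length lam then lam ! (i - 1) else 0)"

definition conj_part :: "nat list \<Rightarrow> nat \<Rightarrow> nat" where
  "conj_part lam j = card {i \<in> {1..length lam}. j \<le> part lam i}"

definition diagram :: "nat list \<Rightarrow> (nat \<times> nat) set" where
  "diagram lam = {(i, j). 1 \<le> i \<and> i \<le> length lam \<and> 1 \<le> j \<and> j \<le> part lam i}"

definition durfee :: "nat list \<Rightarrow> nat" where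
  "durfee lam = card {i \<in> {1..length lam}. i \<le> part lam i}"

definition frob_p :: "nat list \<Rightarrow> nat \<Rightarrow> nat" where
  "frob_p lam i = part lam i - i"

definition frob_q :: "nat list \<Rightarrow> nat \<Rightarrow> nat" where
  "frob_q lam i = conj_part lam i - i"

definition SSYT :: "nat list \<Rightarrow> (nat \<times> nat \<Rightarrow> nat) set" where
  "SSYT lam = {M. (\<forall>b\<in>diagram lam. 1 \<le> M b) \<and> (\<forall>b. b \<notin> diagram lam \<longrightarrow> M b = 0)
      \<and> (\<forall>i j. (i, j) \<in> diagram lam \<and> (i, Suc j) \<in> diagram lam \<longrightarrow> M (i, j) \<le> M (i, Suc j))
      \<and> (\<forall>i j. (i, j) \<in> diagram lam \<and> (Suc i, j) \<in> diagram lam \<longrightarrow> M (i, j) < M (Suc i, j))}"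

definition schur_term :: "nat list \<Rightarrow> (nat \<times> nat \<Rightarrow> complex) \<Rightarrow> (nat \<times> nat \<Rightarrow> nat) \<Rightarrow> complex" where
  "schur_term lam s M = (\<Prod>b\<in>diagram lam. (of_nat (M b)) powr (- s b))"

definition schur_zeta :: "nat list \<Rightarrow> (nat \<times> nat \<Rightarrow> complex) \<Rightarrow> complex" where
  "schur_zeta lam s = infsum (schur_term lam s) (SSYT lam)"

definition zeta_bullet_H :: "nat \<Rightarrow> (nat \<Rightarrow> complex) \<Rightarrow> real \<Rightarrow> complex" where
  "zeta_bullet_H r w x = infsum
     (\<lambda>a. \<Prod>j\<in>{1..r}. (complex_of_real (x + real (\<Sum>i\<in>{1..j}. a i))) powr (- w j))
     {a :: nat \<Rightarrow> nat. \<forall>i. i \<notin> {1..r} \<longrightarrow> a i = 0}"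

definition zeta_H :: "nat \<Rightarrow> (nat \<Rightarrow> complex) \<Rightarrow> real \<Rightarrow> complex" where
  "zeta_H r w x = infsum
     (\<lambda>b. \<Prod>j\<in>{1..r}. (complex_of_real (x + real (\<Sum>i\<in>{1..j}. b i))) powr (- w j))
     {b :: nat \<Rightarrow> nat. (\<forall>i\<in>{1..r}. 1 \<le> b i) \<and> (\<forall>i. i \<notin> {1..r} \<longrightarrow> b i = 0)}"

end

theory Submission
  imports Defs
begin

text \<open>
  The determinant on the right is a Giambelli determinant: summing over \<open>m\<close> for fixed \<open>\<sigma>\<close> turns it
  into \<open>det (\<zeta>(hook p\<^sub>i q\<^sub>j))\<close>, where the sum over a hook factorises once its corner entry is fixed.
  Giambelli's formula is proved for tableaux whose pairs (entry, content) are lexicographically below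
  a threshold \<open>(n, c)\<close>. When the threshold passes \<open>(n, c)\<close>, a tableau of shape \<open>D\<close> can newly
  contain the entry \<open>n\<close> at content \<open>c\<close>, and then only in the unique corner \<open>b\<close> of \<open>D\<close> with that
  content; so the generating function changes by \<open>w n c\<close> times that of \<open>D - {b}\<close>. On Frobenius
  coordinates removing \<open>b\<close> lowers one \<open>p\<^sub>i\<close> or \<open>q\<^sub>j\<close> by one (or drops the last pair \<open>(0|0)\<close>), and
  hooks obey the same rule, so the determinant changes by the matching row or column operation.
  For absolute convergence, the largest entry of a tableau sits at a corner, where the exponent has
  room to spare; that surplus decay is distributed evenly over all boxes.
\<close>

section \<open>Determinants indexed by initial segments\<close>

text \<open>A size argument and functions on \<open>nat\<close> replace a matrix type, because the
  Giambelli induction varies \<open>N\<close> and overwrites single rows.\<close>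

definition detn :: "nat \<Rightarrow> (nat \<Rightarrow> nat \<Rightarrow> 'a::comm_ring_1) \<Rightarrow> 'a" where
  "detn N A = (\<Sum>\<sigma>\<in>{\<sigma>. \<sigma> permutes {1..N}}. of_int (sign \<sigma>) * (\<Prod>k\<in>{1..N}. A k (\<sigma> k)))"

lemma detn_cong:
  assumes "\<And>i j. i \<in> {1..N} \<Longrightarrow> j \<in> {1..N} \<Longrightarrow> A i j = B i j"
  shows "detn N A = detn N B"
  unfolding detn_def using assms permutes_in_image
  by (intro sum.cong arg_cong2[where f="(*)"] prod.cong) fastforce+

lemma detn_0 [simp]: "detn 0 A = 1"
  by (simp add: detn_def)

lemma detn_transpose: "detn N (\<lambda>i j. A j i) = detn N A"
proof -
  let ?P = "{\<sigma>. \<sigma> permutes {1..N}}"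
  have "detn N (\<lambda>i j. A j i) = (\<Sum>\<sigma>\<in>?P. of_int (sign (inv \<sigma>)) * (\<Prod>k\<in>{1..N}. A (inv \<sigma> k) k))"
    unfolding detn_def
    by (rule sum.reindex_bij_witness[of _ inv inv])
      (auto simp: permutes_inv permutes_inv_inv)
  also have "\<dots> = detn N A"
    unfolding detn_def
  proof (intro sum.cong refl arg_cong2[where f="(*)"])
    fix \<sigma> assume "\<sigma> \<in> ?P"
    then have s: "\<sigma> permutes {1..N}" by simp
    show "of_int (sign (inv \<sigma>)) = (of_int (sign \<sigma>) :: 'a)"
      using s by (metis finite_atLeastAtMost permutation_permutes sign_inverse)
    have "(\<Prod>k\<in>{1..N}. A (inv \<sigma> k) k) = (\<Prod>k\<in>{1..N}. A (inv \<sigma> (\<sigma> k)) (\<sigma> k))"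
      using prod.permute[OF s, of "\<lambda>k. A (inv \<sigma> k) k"] by (simp add: o_def)
    then show "(\<Prod>k\<in>{1..N}. A (inv \<sigma> k) k) = (\<Prod>k\<in>{1..N}. A k (\<sigma> k))"
      using permutes_inverses(2)[OF s] by simp
  qed
  finally show ?thesis .
qed

text \<open>Each permutation picks exactly one entry from row \<open>k\<close>, so every summand is
  affine in that row. \<open>B\<close> and \<open>C\<close> are full matrices agreeing with
  \<open>A\<close> elsewhere, so that they can be recognised as the determinants of other
  shapes.\<close>

lemma detn_row_add:
  assumes k: "k \<in> {1..N}"
    and row: "\<And>j. j \<in> {1..N} \<Longrightarrow> A k j = B k j + x * C k j"
    and B: "\<And>i j. i \<in> {1..N} \<Longrightarrow> j \<in> {1..N} \<Longrightarrow> i \<noteq> k \<Longrightarrow> B i j = A i j"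
    and C: "\<And>i j. i \<in> {1..N} \<Longrightarrow> j \<in> {1..N} \<Longrightarrow> i \<noteq> k \<Longrightarrow> C i j = A i j"
  shows "detn N A = detn N B + x * detn N C"
proof -
  have split: "(\<Prod>i\<in>{1..N}. A i (\<sigma> i)) = (\<Prod>i\<in>{1..N}. B i (\<sigma> i)) + x * (\<Prod>i\<in>{1..N}. C i (\<sigma> i))"
    if s: "\<sigma> permutes {1..N}" for \<sigma>
  proof -
    have im: "\<sigma> i \<in> {1..N}" if "i \<in> {1..N}" for i
      using permutes_in_image[OF s] that by blast
    have "(\<Prod>i\<in>{1..N}-{k}. B i (\<sigma> i)) = (\<Prod>i\<in>{1..N}-{k}. A i (\<sigma> i))"
      using im B by (intro prod.cong) auto
    moreover have "(\<Prod>i\<in>{1..N}-{k}. C i (\<sigma> i)) = (\<Prod>i\<in>{1..N}-{k}. A i (\<sigma> i))"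
      using im C by (intro prod.cong) auto
    ultimately show ?thesis
      using row[OF im[OF k]]
      by (simp only: prod.remove[OF finite_atLeastAtMost k]) (simp add: algebra_simps)
  qed
  show ?thesis
    unfolding detn_def sum_distrib_left sum.distrib[symmetric]
  proof (intro sum.cong refl)
    fix \<sigma> assume "\<sigma> \<in> {\<sigma>. \<sigma> permutes {1..N}}"
    then have s: "\<sigma> permutes {1..N}" by simp
    show "of_int (sign \<sigma>) * (\<Prod>k\<in>{1..N}. A k (\<sigma> k)) =
      of_int (sign \<sigma>) * (\<Prod>k\<in>{1..N}. B k (\<sigma> k)) + x * (of_int (sign \<sigma>) * (\<Prod>k\<in>{1..N}. C k (\<sigma> k)))"
      unfolding split[OF s] by (simp add: algebra_simps)
  qed
qed

text \<open>Composing \<open>\<sigma>\<close> with the transposition of \<open>a\<close> and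
  \<open>b\<close> keeps every product and flips its sign, so the determinant equals its own
  negative; characteristic 0 then forces it to vanish.\<close>

lemma detn_identical_rows:
  fixes A :: "nat \<Rightarrow> nat \<Rightarrow> 'a::{idom, ring_char_0}"
  assumes ab: "a \<in> {1..N}" "b \<in> {1..N}" "a \<noteq> b"
    and eq: "\<And>j. j \<in> {1..N} \<Longrightarrow> A a j = A b j"
  shows "detn N A = 0"
proof -
  let ?P = "{\<sigma>. \<sigma> permutes {1..N}}" and ?t = "Transposition.transpose a b"
  have t: "?t permutes {1..N}" using ab by (simp add: permutes_swap_id)
  have "detn N A = (\<Sum>\<sigma>\<in>?P. of_int (sign (\<sigma> \<circ> ?t)) * (\<Prod>k\<in>{1..N}. A k ((\<sigma> \<circ> ?t) k)))"
    unfolding detn_def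
    by (rule sum.reindex_bij_witness[of _ "\<lambda>\<sigma>. \<sigma> \<circ> ?t" "\<lambda>\<sigma>. \<sigma> \<circ> ?t"])
      (auto simp: o_assoc[symmetric] intro!: permutes_compose[OF t[simplified]])
  also have "\<dots> = (\<Sum>\<sigma>\<in>?P. - (of_int (sign \<sigma>) * (\<Prod>k\<in>{1..N}. A k (\<sigma> k))))"
  proof (intro sum.cong refl)
    fix \<sigma> assume "\<sigma> \<in> ?P"
    then have s: "\<sigma> permutes {1..N}" by simp
    have "sign (\<sigma> \<circ> ?t) = - sign \<sigma>"
      using ab s t by (subst sign_compose) (auto simp: sign_swap_id intro: permutation_permutes[THEN iffD2])
    moreover have "(\<Prod>k\<in>{1..N}. A k ((\<sigma> \<circ> ?t) k)) = (\<Prod>k\<in>{1..N}. A (?t k) (\<sigma> k))"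
      using prod.permute[OF t, of "\<lambda>k. A k ((\<sigma> \<circ> ?t) k)"] by (simp add: o_def)
    moreover have "\<dots> = (\<Prod>k\<in>{1..N}. A k (\<sigma> k))"
    proof (intro prod.cong refl)
      fix k assume "k \<in> {1..N}"
      then have "\<sigma> k \<in> {1..N}" using permutes_in_image[OF s] by blast
      then show "A (?t k) (\<sigma> k) = A k (\<sigma> k)"
        using eq by (cases "k = a"; cases "k = b") auto
    qed
    ultimately show "of_int (sign (\<sigma> \<circ> ?t)) * (\<Prod>k\<in>{1..N}. A k ((\<sigma> \<circ> ?t) k)) = - (of_int (sign \<sigma>) * (\<Prod>k\<in>{1..N}. A k (\<sigma> k)))"
      by simp
  qed
  also have "\<dots> = - detn N A" by (simp add: detn_def sum_negf)
  finally have "2 * detn N A = 0" by (simp only: mult_2 eq_neg_iff_add_eq_0)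
  then show ?thesis by simp
qed

text \<open>A permutation moving \<open>Suc N\<close> meets a zero in the last row; the remaining
  ones are the permutations of \<open>{1..N}\<close>. This is how the determinant shrinks when the
  last pair \<open>(0|0)\<close> is dropped.\<close>

lemma detn_last_row_unit:
  assumes "\<And>j. j \<in> {1..N} \<Longrightarrow> A (Suc N) j = 0" "A (Suc N) (Suc N) = 1"
  shows "detn (Suc N) A = detn N A"
proof -
  let ?f = "\<lambda>\<sigma>. of_int (sign \<sigma>) * (\<Prod>k\<in>{1..Suc N}. A k (\<sigma> k))"
  have "detn (Suc N) A = sum ?f {\<sigma>. \<sigma> permutes {1..N}}"
    unfolding detn_def
  proof (rule sum.mono_neutral_right)
    show "finite {\<sigma>. \<sigma> permutes {1..Suc N}}" by (simp add: finite_permutations)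
    show "{\<sigma>. \<sigma> permutes {1..N}} \<subseteq> {\<sigma>. \<sigma> permutes {1..Suc N}}"
      by (auto intro: permutes_subset)
    show "\<forall>\<sigma>\<in>{\<sigma>. \<sigma> permutes {1..Suc N}} - {\<sigma>. \<sigma> permutes {1..N}}. ?f \<sigma> = 0"
    proof
      fix \<sigma> assume a: "\<sigma> \<in> {\<sigma>. \<sigma> permutes {1..Suc N}} - {\<sigma>. \<sigma> permutes {1..N}}"
      then have s: "\<sigma> permutes {1..Suc N}" by simp
      have ne: "\<sigma> (Suc N) \<noteq> Suc N"
      proof
        assume "\<sigma> (Suc N) = Suc N"
        then have "\<sigma> permutes {1..N}"
          using s by (intro permutes_superset[OF s]) (auto simp: le_Suc_eq)
        then show False using a by simp
      qed
      have "\<sigma> (Suc N) \<in> {1..Suc N}"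
        using permutes_in_image[OF s] by fastforce
      then have "\<sigma> (Suc N) \<in> {1..N}" using ne by auto
      then have "A (Suc N) (\<sigma> (Suc N)) = 0" using assms(1) by simp
      then show "?f \<sigma> = 0" by simp
    qed
  qed
  also have "\<dots> = detn N A"
    unfolding detn_def
  proof (intro sum.cong refl)
    fix \<sigma> assume "\<sigma> \<in> {\<sigma>. \<sigma> permutes {1..N}}"
    then have "\<sigma> (Suc N) = Suc N" by (simp add: permutes_not_in)
    then show "?f \<sigma> = of_int (sign \<sigma>) * (\<Prod>k\<in>{1..N}. A k (\<sigma> k))"
      using assms(2) by simp
  qed
  finally show ?thesis .
qed

section \<open>Tableaux below a threshold\<close>

definition content :: "nat \<times> nat \<Rightarrow> int" where
  "content b = int (snd b) - int (fst b)"

definition young :: "(nat \<times> nat) set \<Rightarrow> bool" where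
  "young D \<longleftrightarrow> finite D \<and> (\<forall>i j. (i, j) \<in> D \<longrightarrow> 1 \<le> i \<and> 1 \<le> j) \<and>
     (\<forall>i j i' j'. (i, j) \<in> D \<and> 1 \<le> i' \<and> i' \<le> i \<and> 1 \<le> j' \<and> j' \<le> j \<longrightarrow> (i', j') \<in> D)"

definition corner :: "(nat \<times> nat) set \<Rightarrow> nat \<times> nat \<Rightarrow> bool" where
  "corner D b \<longleftrightarrow> b \<in> D \<and> (Suc (fst b), snd b) \<notin> D \<and> (fst b, Suc (snd b)) \<notin> D"

definition tableaux :: "(nat \<times> nat) set \<Rightarrow> (nat \<times> nat \<Rightarrow> nat) set" where
  "tableaux D = {M. (\<forall>b\<in>D. 1 \<le> M b) \<and> (\<forall>b. b \<notin> D \<longrightarrow> M b = 0)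
      \<and> (\<forall>i j. (i, j) \<in> D \<and> (i, Suc j) \<in> D \<longrightarrow> M (i, j) \<le> M (i, Suc j))
      \<and> (\<forall>i j. (i, j) \<in> D \<and> (Suc i, j) \<in> D \<longrightarrow> M (i, j) < M (Suc i, j))}"

definition tableaux_below :: "nat \<Rightarrow> int \<Rightarrow> (nat \<times> nat) set \<Rightarrow> (nat \<times> nat \<Rightarrow> nat) set" where
  "tableaux_below n c D = {M \<in> tableaux D. \<forall>b\<in>D. M b < n \<or> M b = n \<and> content b < c}"

definition partial_schur :: "(nat \<Rightarrow> int \<Rightarrow> complex) \<Rightarrow> nat \<Rightarrow> int \<Rightarrow> (nat \<times> nat) set \<Rightarrow> complex" where
  "partial_schur w n c D = (\<Sum>M\<in>tableaux_below n c D. \<Prod>b\<in>D. w (M b) (content b))"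

lemma content_simp [simp]: "content (i, j) = int j - int i"
  by (simp add: content_def)

lemma tableaux_belowI:
  assumes "\<And>b. b \<in> D \<Longrightarrow> 1 \<le> M b" "\<And>b. b \<notin> D \<Longrightarrow> M b = 0"
    and "\<And>i j. (i, j) \<in> D \<Longrightarrow> (i, Suc j) \<in> D \<Longrightarrow> M (i, j) \<le> M (i, Suc j)"
    and "\<And>i j. (i, j) \<in> D \<Longrightarrow> (Suc i, j) \<in> D \<Longrightarrow> M (i, j) < M (Suc i, j)"
    and "\<And>b. b \<in> D \<Longrightarrow> M b < n \<or> M b = n \<and> content b < c"
  shows "M \<in> tableaux_below n c D"
  unfolding tableaux_below_def tableaux_def using assms by blast

lemma tableaux_belowD:
  assumes "M \<in> tableaux_below n c D"
  shows "b \<in> D \<Longrightarrow> 1 \<le> M b" "b \<notin> D \<Longrightarrow> M b = 0"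
    and "(i, j) \<in> D \<Longrightarrow> (i, Suc j) \<in> D \<Longrightarrow> M (i, j) \<le> M (i, Suc j)"
    and "(i, j) \<in> D \<Longrightarrow> (Suc i, j) \<in> D \<Longrightarrow> M (i, j) < M (Suc i, j)"
    and "b \<in> D \<Longrightarrow> M b < n \<or> M b = n \<and> content b < c"
  using assms unfolding tableaux_below_def tableaux_def by blast+

lemma tableaux_below_mono:
  assumes M: "M \<in> tableaux_below n c D" and "c \<le> c'"
  shows "M \<in> tableaux_below n c' D"
  by (rule tableaux_belowI) (use tableaux_belowD[OF M] assms(2) in \<open>fastforce dest: order_less_le_trans\<close>)+

lemma SSYT_eq_tableaux: "SSYT lam = tableaux (diagram lam)"
  by (simp add: SSYT_def tableaux_def)

lemma finite_tableaux_below: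
  assumes "finite D"
  shows "finite (tableaux_below n c D)"
proof (rule finite_subset)
  show "tableaux_below n c D \<subseteq> {M. \<forall>b. (b \<in> D \<longrightarrow> M b \<in> {..n}) \<and> (b \<notin> D \<longrightarrow> M b = 0)}"
    by (auto simp: tableaux_below_def tableaux_def)
qed (rule finite_set_of_finite_funs; use assms in simp)

text \<open>\<open>(n, c)\<close> is the largest pair the threshold allows. The box below would need
  an entry above \<open>n\<close>, and the box to the right an entry at least \<open>n\<close> at
  content \<open>c + 1\<close>; neither fits.\<close>

lemma tableaux_below_max_corner:
  assumes M: "M \<in> tableaux_below n (c + 1) D" and b: "b \<in> D" "M b = n" "content b = c"
  shows "corner D b"
proof -
  obtain i j where ij: "b = (i, j)" by fastforce
  have "(Suc i, j) \<notin> D"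
  proof
    assume d: "(Suc i, j) \<in> D"
    then have "M (i, j) < M (Suc i, j)" using M b ij by (auto simp: tableaux_below_def tableaux_def)
    moreover have "M (Suc i, j) \<le> n" using M d by (auto simp: tableaux_below_def)
    ultimately show False using b ij by simp
  qed
  moreover have "(i, Suc j) \<notin> D"
  proof
    assume d: "(i, Suc j) \<in> D"
    then have "M (i, j) \<le> M (i, Suc j)" using M b ij by (auto simp: tableaux_below_def tableaux_def)
    moreover have "M (i, Suc j) < n" using M d b ij by (auto simp: tableaux_below_def)
    ultimately show False using b ij by simp
  qed
  ultimately show ?thesis using b ij by (simp add: corner_def)
qed

lemma partial_schur_no_corner:
  assumes "\<And>b. corner D b \<Longrightarrow> content b \<noteq> c"
  shows "partial_schur w n (c + 1) D = partial_schur w n c D"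
proof -
  have "tableaux_below n (c + 1) D = tableaux_below n c D"
  proof
    show "tableaux_below n (c + 1) D \<subseteq> tableaux_below n c D"
    proof
      fix M assume M: "M \<in> tableaux_below n (c + 1) D"
      have "M b < n \<or> M b = n \<and> content b < c" if "b \<in> D" for b
        using M that assms tableaux_below_max_corner[OF M that]
        by (fastforce simp: tableaux_below_def)
      then show "M \<in> tableaux_below n c D" using M by (simp add: tableaux_below_def)
    qed
    show "tableaux_below n c D \<subseteq> tableaux_below n (c + 1) D"
      by (fastforce simp: tableaux_below_def)
  qed
  then show ?thesis by (simp add: partial_schur_def)
qed

text \<open>If two corners lay on one diagonal, the lower right one would force the box just below
  the upper left one into \<open>D\<close>.\<close>

lemma corner_content_inj:
  assumes D: "young D" and "corner D b" "corner D b'" "content b = content b'"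
  shows "b = b'"
proof -
  obtain i j i' j' where e: "b = (i, j)" "b' = (i', j')" by fastforce
  have in_D: "(i, j) \<in> D" "(i', j') \<in> D" using assms e by (auto simp: corner_def)
  have pos: "1 \<le> i" "1 \<le> j" "1 \<le> i'" "1 \<le> j'" using in_D D unfolding young_def by blast+
  consider "i < i'" | "i' < i" | "i = i'" by linarith
  then show ?thesis
  proof cases
    case 1
    then have "(Suc i, j) \<in> D" using D in_D(2) pos assms(4) e unfolding young_def
      by (elim conjE allE[of _ i'] allE[of _ j'] allE[of _ "Suc i"] allE[of _ j]) auto
    then show ?thesis using assms(2) e by (simp add: corner_def)
  next
    case 2
    then have "(Suc i', j') \<in> D" using D in_D(1) pos assms(4) e unfolding young_def
      by (elim conjE allE[of _ i] allE[of _ j] allE[of _ "Suc i'"] allE[of _ j']) auto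
    then show ?thesis using assms(3) e by (simp add: corner_def)
  next
    case 3
    then show ?thesis using assms(4) e by simp
  qed
qed

lemma partial_schur_corner:
  assumes D: "young D" and b: "corner D b" and n: "1 \<le> n"
  shows "partial_schur w n (content b + 1) D =
    partial_schur w n (content b) D + w n (content b) * partial_schur w n (content b) (D - {b})"
proof -
  let ?c = "content b"
  let ?S = "tableaux_below n ?c (D - {b})"
  let ?u = "\<lambda>M :: nat \<times> nat \<Rightarrow> nat. M(b := n)"
  obtain i j where ij: "b = (i, j)" by fastforce
  have fin: "finite D" using D unfolding young_def by blast
  have bD: "b \<in> D" and cor: "(Suc i, j) \<notin> D" "(i, Suc j) \<notin> D"
    using b ij by (auto simp: corner_def)
  \<comment> \<open>The tableaux gained are exactly those with entry \<open>n\<close> in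
    \<open>b\<close>; they arise from tableaux of \<open>D - {b}\<close> under the old threshold by
    writing \<open>n\<close> into \<open>b\<close>.\<close>
  have split: "tableaux_below n (?c + 1) D = tableaux_below n ?c D \<union> ?u ` ?S"
  proof (rule set_eqI, rule iffI)
    fix M assume M: "M \<in> tableaux_below n (?c + 1) D"
    have other: "M b' < n \<or> M b' = n \<and> content b' < ?c" if "b' \<in> D" "b' \<noteq> b" for b'
    proof -
      have "\<not> (M b' = n \<and> content b' = ?c)"
        using that corner_content_inj[OF D b, of b'] tableaux_below_max_corner[OF M that(1)] by metis
      then show ?thesis using tableaux_belowD(5)[OF M that(1)] by linarith
    qed
    show "M \<in> tableaux_below n ?c D \<union> ?u ` ?S"
    proof (cases "M b = n")
      case True
      have "M(b := 0) \<in> ?S"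
        using other tableaux_belowD[OF M] by (intro tableaux_belowI) (simp_all, blast)
      moreover have "M = ?u (M(b := 0))" using True by (simp add: fun_upd_idem)
      ultimately show ?thesis by (intro UnI2 image_eqI[of _ _ "M(b := 0)"])
    next
      case False
      have "M \<in> tableaux_below n ?c D"
      proof (rule tableaux_belowI)
        fix b' assume "b' \<in> D"
        then show "M b' < n \<or> M b' = n \<and> content b' < ?c"
          using other[of b'] tableaux_belowD(5)[OF M bD] False by metis
      qed (use tableaux_belowD[OF M] in blast)+
      then show ?thesis by blast
    qed
  next
    fix M assume "M \<in> tableaux_below n ?c D \<union> ?u ` ?S"
    then show "M \<in> tableaux_below n (?c + 1) D"
    proof (elim UnE imageE)
      assume "M \<in> tableaux_below n ?c D"
      then show ?thesis by (rule tableaux_below_mono) simp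
    next
      fix M' assume M: "M = ?u M'" and M': "M' \<in> ?S"
      note T = tableaux_belowD[OF M']
      have below: "M' b' < n \<or> M' b' = n \<and> content b' < ?c" if "b' \<in> D" "b' \<noteq> b" for b'
        using T(5) that by simp
      show ?thesis
      proof (rule tableaux_belowI)
        fix b'
        show "1 \<le> M b'" if "b' \<in> D" using T(1)[of b'] that n by (simp add: M)
        show "M b' = 0" if "b' \<notin> D" using T(2)[of b'] that bD by (auto simp: M)
        show "M b' < n \<or> M b' = n \<and> content b' < ?c + 1" if "b' \<in> D"
          using below[of b'] that by (cases "b' = b") (auto simp: M)
      next
        fix i' j' assume d: "(i', j') \<in> D" "(i', Suc j') \<in> D"
        have "(i', j') \<noteq> b" using d cor ij by auto
        then show "M (i', j') \<le> M (i', Suc j')"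
          using T(3)[of i' j'] below[OF d(1)] d by (cases "(i', Suc j') = b") (auto simp: M)
      next
        fix i' j' assume d: "(i', j') \<in> D" "(Suc i', j') \<in> D"
        have ne: "(i', j') \<noteq> b" using d cor ij by auto
        \<comment> \<open>The box above \<open>b\<close> has content \<open>?c + 1\<close>, so the
          threshold keeps its entry strictly below \<open>n\<close>. In the row case the box to the
          left may itself carry \<open>n\<close>.\<close>
        have "M' (i', j') < n" if "(Suc i', j') = b"
          using below[OF d(1) ne] that by (auto simp: content_def)
        then show "M (i', j') < M (Suc i', j')"
          using T(4)[of i' j'] d ne by (cases "(Suc i', j') = b") (auto simp: M)
      qed
    qed
  qed
  have "M b < n" if "M \<in> tableaux_below n ?c D" for M
    using tableaux_belowD(5)[OF that bD] by simp
  then have disj: "tableaux_below n ?c D \<inter> ?u ` ?S = {}"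
    by fastforce
  have inj: "inj_on ?u ?S"
  proof (rule inj_onI)
    fix M M' assume "M \<in> ?S" "M' \<in> ?S" and eq: "?u M = ?u M'"
    then have "M b = 0" "M' b = 0" using tableaux_belowD(2)[of _ n ?c "D - {b}" b] by blast+
    then show "M = M'" using eq by (metis fun_upd_triv fun_upd_upd)
  qed
  have wt: "(\<Prod>b'\<in>D. w (?u M b') (content b')) = w n ?c * (\<Prod>b'\<in>D - {b}. w (M b') (content b'))" for M
    by (subst prod.remove[OF fin bD]) (auto intro!: prod.cong arg_cong2[where f="(*)"])
  show ?thesis
    unfolding partial_schur_def split
    by (subst sum.union_disjoint)
      (use fin disj in \<open>auto simp: finite_tableaux_below sum.reindex[OF inj] wt sum_distrib_left simp del: fun_upd_apply\<close>)
qed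

lemma partial_schur_empty [simp]: "partial_schur w n c {} = 1"
proof -
  have "tableaux_below n c {} = {\<lambda>_. 0}"
    by (auto simp: tableaux_below_def tableaux_def)
  then show ?thesis by (simp add: partial_schur_def)
qed

section \<open>Giambelli's formula below a threshold\<close>

text \<open>Union of the arm and the leg of each diagonal box \<open>(i, i)\<close> with
  \<open>i <= N\<close>. Coordinates are functions, so shortening an arm or a leg at a corner is a
  function update.\<close>

definition frob_diagram :: "nat \<Rightarrow> (nat \<Rightarrow> nat) \<Rightarrow> (nat \<Rightarrow> nat) \<Rightarrow> (nat \<times> nat) set" where
  "frob_diagram N p q = {(i, j). (1 \<le> i \<and> i \<le> N \<and> i \<le> j \<and> j \<le> i + p i) \<or>
                                 (1 \<le> j \<and> j \<le> N \<and> j \<le> i \<and> i \<le> j + q j)}"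

definition strict_dec :: "nat \<Rightarrow> (nat \<Rightarrow> nat) \<Rightarrow> bool" where
  "strict_dec N p \<longleftrightarrow> (\<forall>i j. 1 \<le> i \<and> i < j \<and> j \<le> N \<longrightarrow> p j < p i)"

abbreviation hook :: "nat \<Rightarrow> nat \<Rightarrow> (nat \<times> nat) set" where
  "hook p q \<equiv> frob_diagram (Suc 0) (\<lambda>_. p) (\<lambda>_. q)"

lemma strict_dec_1 [simp]: "strict_dec (Suc 0) p"
  by (auto simp: strict_dec_def)

lemma strict_decD: "strict_dec N p \<Longrightarrow> 1 \<le> i \<Longrightarrow> i < j \<Longrightarrow> j \<le> N \<Longrightarrow> p j < p i"
  by (auto simp: strict_dec_def)

text \<open>For strictly decreasing coordinates \<open>i + p i\<close> is the length of row
  \<open>i\<close> (of column \<open>i\<close> when applied to \<open>q\<close>), so this is weak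
  decrease of row lengths.\<close>

lemma strict_dec_shift:
  assumes p: "strict_dec N p" and "1 \<le> i"
  shows "i \<le> j \<Longrightarrow> j \<le> N \<Longrightarrow> j + p j \<le> i + p i"
proof (induction j rule: dec_induct)
  case (step j)
  then show ?case using strict_decD[OF p, of j "Suc j"] assms(2) by auto
qed simp

lemma strict_dec_ne: "strict_dec N p \<Longrightarrow> i \<in> {1..N} \<Longrightarrow> j \<in> {1..N} \<Longrightarrow> i \<noteq> j \<Longrightarrow> p i \<noteq> p j"
  using strict_decD[of N p i j] strict_decD[of N p j i] by (cases "i < j") auto

text \<open>Only the next coordinate can collide with the lowered one. The excluded case
  \<open>Suc (p (Suc k)) = p k\<close> is the one in which rows \<open>k\<close> and
  \<open>Suc k\<close> have equal length, so that row \<open>k\<close> does not end in a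
  corner.\<close>

lemma strict_dec_decrement:
  assumes p: "strict_dec N p" and k: "k \<in> {1..N}" "0 < p k" and gap: "k < N \<Longrightarrow> Suc (p (Suc k)) \<noteq> p k"
  shows "strict_dec N (p(k := p k - 1))"
  unfolding strict_dec_def
proof (intro allI impI)
  fix i j assume ij: "1 \<le> i \<and> i < j \<and> j \<le> N"
  have a: "p j < p i" using ij strict_decD[OF p] by blast
  have b: "p j < p k - 1" if "i = k"
  proof -
    have "j + p j \<le> Suc k + p (Suc k)" using ij that by (intro strict_dec_shift[OF p]) auto
    moreover have "p (Suc k) < p k" using ij that k by (intro strict_decD[OF p]) auto
    ultimately show ?thesis using gap ij that by auto
  qed
  show "(p(k := p k - 1)) j < (p(k := p k - 1)) i"
    using a b ij by auto
qed

lemma young_frob_diagram: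
  assumes p: "strict_dec N p" and q: "strict_dec N q"
  shows "young (frob_diagram N p q)"
proof -
  have "finite (frob_diagram N p q)"
  proof (rule finite_subset)
    show "frob_diagram N p q \<subseteq> (\<Union>i\<in>{1..N}. {i} \<times> {..i + p i}) \<union> (\<Union>j\<in>{1..N}. {..j + q j} \<times> {j})"
      by (auto simp: frob_diagram_def)
  qed auto
  moreover have "(i', j') \<in> frob_diagram N p q"
    if "(i, j) \<in> frob_diagram N p q" and le: "1 \<le> i'" "i' \<le> i" "1 \<le> j'" "j' \<le> j" for i j i' j'
  proof -
    have A: "i + p i \<le> i' + p i'" if "i \<le> N" using strict_dec_shift[OF p le(1,2) that] .
    have B: "j + q j \<le> j' + q j'" if "j \<le> N" using strict_dec_shift[OF q le(3,4) that] .
    \<comment> \<open>\<open>C\<close> and \<open>E\<close> serve boxes on opposite sides of the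
      diagonal: a leg starting at \<open>j'\<close> reaches at least row \<open>i\<close> because
      the diagonal box \<open>(i, i)\<close> belongs to the shape, and likewise an arm starting at
      \<open>i'\<close> reaches at least column \<open>j\<close>.\<close>
    have C: "i' \<le> j' + q j'" if "i \<le> N" "j' < i'"
      using strict_dec_shift[OF q le(3), of i] that le by linarith
    have E: "j' \<le> i' + p i'" if "j \<le> N" "i' \<le> j'"
      using strict_dec_shift[OF p le(1), of j] that le by linarith
    show ?thesis using that A B C E by (cases "i' \<le> j'") (auto simp: frob_diagram_def)
  qed
  ultimately show ?thesis
    unfolding young_def by (auto simp: frob_diagram_def)
qed

text \<open>Off the diagonal, a corner must end its arm, and the box below is missing exactly when
  row \<open>Suc i\<close> is shorter. Equal lengths of the two rows read
  \<open>Suc (p (Suc i)) = p i\<close>.\<close>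

lemma corner_frob_pos_iff:
  assumes p: "strict_dec N p" and lt: "i < j"
  shows "corner (frob_diagram N p q) (i, j) \<longleftrightarrow>
    i \<in> {1..N} \<and> j = i + p i \<and> (i < N \<longrightarrow> Suc (p (Suc i)) \<noteq> p i)"
  using strict_decD[OF p, of i "Suc i"] lt by (auto simp: corner_def frob_diagram_def)

lemma corner_frob_neg_iff:
  assumes q: "strict_dec N q" and lt: "j < i"
  shows "corner (frob_diagram N p q) (i, j) \<longleftrightarrow>
    j \<in> {1..N} \<and> i = j + q j \<and> (j < N \<longrightarrow> Suc (q (Suc j)) \<noteq> q j)"
  using strict_decD[OF q, of j "Suc j"] lt by (auto simp: corner_def frob_diagram_def)

text \<open>A diagonal box before the last has a nonempty arm, since \<open>p i > p (Suc i)\<close>;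
  hence only \<open>(N, N)\<close> can be a corner, and then only with empty arm and leg.\<close>

lemma corner_frob_zero_iff:
  assumes p: "strict_dec N p" and q: "strict_dec N q"
  shows "corner (frob_diagram N p q) (i, i) \<longleftrightarrow> i = N \<and> 1 \<le> N \<and> p N = 0 \<and> q N = 0"
  using strict_decD[OF q, of i "Suc i"] strict_decD[OF p, of i "Suc i"]
  by (cases i N rule: linorder_cases) (auto simp: corner_def frob_diagram_def)

section \<open>Removing a corner in Frobenius coordinates\<close>

lemma frob_remove_pos:
  "k \<in> {1..N} \<Longrightarrow> 0 < p k \<Longrightarrow>
    frob_diagram N p q - {(k, k + p k)} = frob_diagram N (p(k := p k - 1)) q"
  by (auto simp: frob_diagram_def split: if_splits)

lemma frob_remove_neg:
  "k \<in> {1..N} \<Longrightarrow> 0 < q k \<Longrightarrow>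
    frob_diagram N p q - {(k + q k, k)} = frob_diagram N p (q(k := q k - 1))"
  by (auto simp: frob_diagram_def split: if_splits)

lemma frob_remove_zero:
  assumes "strict_dec (Suc N) p" "strict_dec (Suc N) q" "p (Suc N) = 0" "q (Suc N) = 0"
  shows "frob_diagram (Suc N) p q - {(Suc N, Suc N)} = frob_diagram N p q"
  using assms by (auto simp: frob_diagram_def le_Suc_eq)

lemma frob_diagram_0 [simp]: "frob_diagram 0 p q = {}"
  by (auto simp: frob_diagram_def)

lemma partial_schur_frob_pos:
  assumes p: "strict_dec N p" and q: "strict_dec N q" and n: "1 \<le> n"
    and k: "k \<in> {1..N}" "0 < p k" and gap: "k < N \<Longrightarrow> Suc (p (Suc k)) \<noteq> p k"
  shows "partial_schur w n (int (p k) + 1) (frob_diagram N p q) =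
    partial_schur w n (int (p k)) (frob_diagram N p q) +
    w n (int (p k)) * partial_schur w n (int (p k)) (frob_diagram N (p(k := p k - 1)) q)"
proof -
  have "corner (frob_diagram N p q) (k, k + p k)"
    using corner_frob_pos_iff[OF p, of k "k + p k" q] k gap by auto
  from partial_schur_corner[OF young_frob_diagram[OF p q] this n, of w]
  show ?thesis by (simp add: frob_remove_pos[of k N p, OF k])
qed

lemma partial_schur_frob_neg:
  assumes p: "strict_dec N p" and q: "strict_dec N q" and n: "1 \<le> n"
    and k: "k \<in> {1..N}" "0 < q k" and gap: "k < N \<Longrightarrow> Suc (q (Suc k)) \<noteq> q k"
  shows "partial_schur w n (- int (q k) + 1) (frob_diagram N p q) =
    partial_schur w n (- int (q k)) (frob_diagram N p q) +
    w n (- int (q k)) * partial_schur w n (- int (q k)) (frob_diagram N p (q(k := q k - 1)))"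
proof -
  have "corner (frob_diagram N p q) (k + q k, k)"
    using corner_frob_neg_iff[OF q, of k "k + q k" p] k gap by auto
  from partial_schur_corner[OF young_frob_diagram[OF p q] this n, of w]
  show ?thesis by (simp add: frob_remove_neg[of k N q, OF k])
qed

lemma partial_schur_frob_zero:
  assumes p: "strict_dec (Suc N) p" and q: "strict_dec (Suc N) q" and n: "1 \<le> n"
    and z: "p (Suc N) = 0" "q (Suc N) = 0"
  shows "partial_schur w n 1 (frob_diagram (Suc N) p q) =
    partial_schur w n 0 (frob_diagram (Suc N) p q) + w n 0 * partial_schur w n 0 (frob_diagram N p q)"
proof -
  have "corner (frob_diagram (Suc N) p q) (Suc N, Suc N)"
    using corner_frob_zero_iff[OF p q] z by auto
  from partial_schur_corner[OF young_frob_diagram[OF p q] this n, of w]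
  show ?thesis by (simp add: frob_remove_zero[OF p q z])
qed

lemma partial_schur_frob_none:
  assumes p: "strict_dec N p" and q: "strict_dec N q"
    and pos: "\<And>k. k \<in> {1..N} \<Longrightarrow> 0 < p k \<Longrightarrow> c = int (p k) \<Longrightarrow> k < N \<and> Suc (p (Suc k)) = p k"
    and neg: "\<And>k. k \<in> {1..N} \<Longrightarrow> 0 < q k \<Longrightarrow> c = - int (q k) \<Longrightarrow> k < N \<and> Suc (q (Suc k)) = q k"
    and zero: "c = 0 \<Longrightarrow> 1 \<le> N \<Longrightarrow> p N = 0 \<Longrightarrow> q N \<noteq> 0"
  shows "partial_schur w n (c + 1) (frob_diagram N p q) = partial_schur w n c (frob_diagram N p q)"
proof (rule partial_schur_no_corner)
  fix b assume b: "corner (frob_diagram N p q) b"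
  obtain i j where e: "b = (i, j)" by fastforce
  show "content b \<noteq> c"
  proof
    assume c: "content b = c"
    consider "i < j" | "j < i" | "i = j" by linarith
    then show False
    proof cases
      case 1
      then show False using b c e pos[of i] corner_frob_pos_iff[OF p 1, of q] by auto
    next
      case 2
      then show False using b c e neg[of j] corner_frob_neg_iff[OF q 2, of p] by auto
    next
      case 3
      then show False using b c e zero corner_frob_zero_iff[OF p q, of i] by auto
    qed
  qed
qed

text \<open>The three kinds of removal for \<open>N = 1\<close>. In the branch with
  \<open>c = 0\<close> the hook is a single box, and removing it leaves the empty shape, whose sum
  is 1.\<close>

lemma partial_schur_hook_step:
  assumes n: "1 \<le> n"
  shows "partial_schur w n (c + 1) (hook p q) = partial_schur w n c (hook p q) +
    (if 0 < p \<and> c = int p then w n c * partial_schur w n c (hook (p - 1) q)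
     else if 0 < q \<and> c = - int q then w n c * partial_schur w n c (hook p (q - 1))
     else if c = 0 \<and> p = 0 \<and> q = 0 then w n c else 0)"
proof -
  have upd: "frob_diagram 1 ((\<lambda>_. p)(1 := p')) q' = hook p' (q' 1)"
    "frob_diagram 1 p'' ((\<lambda>_. q)(1 := p')) = hook (p'' 1) p'" for p' q' p''
    by (auto simp: frob_diagram_def split: if_splits)
  consider "0 < p" "c = int p" | "0 < q" "c = - int q" | "c = 0" "p = 0" "q = 0"
    | "\<not> (0 < p \<and> c = int p)" "\<not> (0 < q \<and> c = - int q)" "\<not> (c = 0 \<and> p = 0 \<and> q = 0)" by blast
  then show ?thesis
  proof cases
    case 1
    then show ?thesis
      using partial_schur_frob_pos[of 1 "\<lambda>_. p" "\<lambda>_. q" n 1 w] n upd by simp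
  next
    case 2
    then show ?thesis
      using partial_schur_frob_neg[of 1 "\<lambda>_. p" "\<lambda>_. q" n 1 w] n upd by simp
  next
    case 3
    then show ?thesis
      using partial_schur_frob_zero[of 0 "\<lambda>_. p" "\<lambda>_. q" n w] n by simp
  next
    case 4
    then show ?thesis
      by (subst partial_schur_frob_none) auto
  qed
qed

text \<open>\<open>A\<close> and \<open>A'\<close> take the coordinate value, not the row number, as
  first argument. Since \<open>p\<close> takes the value \<open>d\<close> only once, the change at
  \<open>d\<close> affects row \<open>k\<close> alone, and its correction is the row of the
  coordinate \<open>d - 1\<close>.\<close>

lemma detn_row_step:
  assumes p: "strict_dec N p" and k: "k \<in> {1..N}" "p k = d"
    and step: "\<And>a j. j \<in> {1..N} \<Longrightarrow> A' a j = A a j + (if a = d then x * A (d - 1) j else 0)"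
  shows "detn N (\<lambda>i j. A' (p i) j) =
    detn N (\<lambda>i j. A (p i) j) + x * detn N (\<lambda>i j. A ((p(k := d - 1)) i) j)"
proof (rule detn_row_add[OF k(1)])
  fix i j assume ij: "i \<in> {1..N}" "j \<in> {1..N}" "i \<noteq> k"
  then have "p i \<noteq> d" using strict_dec_ne[OF p ij(1) k(1)] k by auto
  then show "A (p i) j = A' (p i) j" "A ((p(k := d - 1)) i) j = A' (p i) j"
    using ij step by auto
qed (use k step in auto)

text \<open>If the coordinate after position \<open>k\<close> is already \<open>d - 1\<close>,
  lowering the one at \<open>k\<close> to \<open>d - 1\<close> repeats a row. This mirrors the
  absence of a corner at the end of arm \<open>k\<close>.\<close>

lemma detn_row_collision:
  fixes A :: "nat \<Rightarrow> nat \<Rightarrow> 'a::{idom, ring_char_0}"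
  assumes "k \<in> {1..N}" "k < N" "Suc (p (Suc k)) = d"
  shows "detn N (\<lambda>i j. A ((p(k := d - 1)) i) j) = 0"
  using assms by (intro detn_identical_rows[of k N "Suc k"]) auto

text \<open>All sizes and coordinate sequences are quantified together, because a step lowers a
  coordinate or drops a pair. The bound \<open>K\<close> confines contents to \<open>-K..K\<close>,
  so finitely many steps exhaust an entry value.\<close>

definition giambelli :: "(nat \<Rightarrow> int \<Rightarrow> complex) \<Rightarrow> nat \<Rightarrow> nat \<Rightarrow> int \<Rightarrow> bool" where
  "giambelli w K n c \<longleftrightarrow> (\<forall>N p q. strict_dec N p \<and> strict_dec N q \<and> (\<forall>i\<in>{1..N}. p i \<le> K \<and> q i \<le> K) \<longrightarrow>
     partial_schur w n c (frob_diagram N p q) = detn N (\<lambda>i j. partial_schur w n c (hook (p i) (q j))))"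

lemma giambelliD:
  "giambelli w K n c \<Longrightarrow> strict_dec N p \<Longrightarrow> strict_dec N q \<Longrightarrow> (\<And>i. i \<in> {1..N} \<Longrightarrow> p i \<le> K \<and> q i \<le> K) \<Longrightarrow>
     partial_schur w n c (frob_diagram N p q) = detn N (\<lambda>i j. partial_schur w n c (hook (p i) (q j)))"
  by (auto simp: giambelli_def)

text \<open>Content \<open>c > 0\<close> alters the row with \<open>p i = c\<close>,
  \<open>c < 0\<close> the column with \<open>q j = -c\<close>, and \<open>c = 0\<close> only an
  entry with both coordinates 0; in each case the shape side changes in the same way.\<close>

lemma giambelli_step:
  assumes G: "giambelli w K n c" and n: "1 \<le> n"
  shows "giambelli w K n (c + 1)"
  unfolding giambelli_def
proof (intro allI impI, elim conjE)
  fix N p q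
  assume p: "strict_dec N p" and q: "strict_dec N q" and K: "\<forall>i\<in>{1..N}. p i \<le> K \<and> q i \<le> K"
  let ?H = "\<lambda>a b. partial_schur w n c (hook a b)" and ?H' = "\<lambda>a b. partial_schur w n (c + 1) (hook a b)"
  let ?F = "\<lambda>N p q. partial_schur w n c (frob_diagram N p q)"
  let ?F' = "\<lambda>N p q. partial_schur w n (c + 1) (frob_diagram N p q)"
  note hook = partial_schur_hook_step[OF n, of w c]
  have IH: "?F N p q = detn N (\<lambda>i j. ?H (p i) (q j))"
    using giambelliD[OF G p q] K by blast
  have cong: "?F' N p q = detn N (\<lambda>i j. ?H' (p i) (q j))"
    if "?F' N p q = ?F N p q" "\<And>i j. i \<in> {1..N} \<Longrightarrow> j \<in> {1..N} \<Longrightarrow> ?H' (p i) (q j) = ?H (p i) (q j)"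
    unfolding that(1) IH by (rule detn_cong) (rule that(2)[symmetric])
  consider "0 < c" | "c < 0" | "c = 0" by linarith
  then show "?F' N p q = detn N (\<lambda>i j. ?H' (p i) (q j))"
  proof cases
    case 1
    define d where "d = nat c"
    have d: "0 < d" "c = int d" using 1 by (auto simp: d_def)
    have hook: "?H' a b = ?H a b + (if a = d then w n c * ?H (d - 1) b else 0)" for a b
      unfolding hook using d by auto
    show ?thesis
    proof (cases "\<exists>k\<in>{1..N}. p k = d")
      case True
      then obtain k where k: "k \<in> {1..N}" "p k = d" by blast
      have det: "detn N (\<lambda>i j. ?H' (p i) (q j)) =
        ?F N p q + w n c * detn N (\<lambda>i j. ?H ((p(k := d - 1)) i) (q j))"
        unfolding IH
        by (rule detn_row_step[OF p k, where A = "\<lambda>a j. ?H a (q j)" and A' = "\<lambda>a j. ?H' a (q j)"])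
          (rule hook)
      show ?thesis
      \<comment> \<open>If the next coordinate is \<open>d - 1\<close>, there is no corner of
        content \<open>c\<close>: the shape side is constant, and the determinant gains a multiple
        of one with two equal rows.\<close>
      proof (cases "k < N \<and> Suc (p (Suc k)) = d")
        case True
        have "?F' N p q = ?F N p q"
        proof (rule partial_schur_frob_none[OF p q])
          fix k' assume "k' \<in> {1..N}" "c = int (p k')"
          then have "k' = k" using strict_dec_ne[OF p, of k' k] k d by auto
          then show "k' < N \<and> Suc (p (Suc k')) = p k'" using True k by simp
        qed (use d in auto)
        then show ?thesis
          using det detn_row_collision[of k N p d "\<lambda>a j. ?H a (q j)"] k True by simp
      next
        case False
        have "?F' N p q = ?F N p q + w n c * ?F N (p(k := d - 1)) q"
          using partial_schur_frob_pos[OF p q n k(1)] False k d by auto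
        moreover have "?F N (p(k := d - 1)) q = detn N (\<lambda>i j. ?H ((p(k := d - 1)) i) (q j))"
        proof (rule giambelliD[OF G _ q])
          show "strict_dec N (p(k := d - 1))"
            using strict_dec_decrement[OF p k(1)] False k d by auto
        qed (use K k in \<open>auto intro: le_trans[OF diff_le_self]\<close>)
        ultimately show ?thesis using det by simp
      qed
    next
      case False
      have "?F' N p q = ?F N p q"
        using False d by (intro partial_schur_frob_none[OF p q]) auto
      then show ?thesis by (rule cong) (use False in \<open>subst hook, auto\<close>)
    qed
  next
    case 2
    define d where "d = nat (- c)"
    have d: "0 < d" "c = - int d" using 2 by (auto simp: d_def)
    have hook: "?H' a b = ?H a b + (if b = d then w n c * ?H a (d - 1) else 0)" for a b
      unfolding hook using d by auto
    show ?thesis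
    proof (cases "\<exists>k\<in>{1..N}. q k = d")
      case True
      then obtain k where k: "k \<in> {1..N}" "q k = d" by blast
      \<comment> \<open>Column \<open>k\<close> becomes a row after transposing;
        \<open>detn_transpose\<close> undoes this below.\<close>
      have "detn N (\<lambda>j i. ?H' (p i) (q j)) =
        detn N (\<lambda>j i. ?H (p i) (q j)) + w n c * detn N (\<lambda>j i. ?H (p i) ((q(k := d - 1)) j))"
        by (rule detn_row_step[OF q k, where A = "\<lambda>b i. ?H (p i) b" and A' = "\<lambda>b i. ?H' (p i) b"])
          (rule hook)
      then have det: "detn N (\<lambda>i j. ?H' (p i) (q j)) =
        ?F N p q + w n c * detn N (\<lambda>i j. ?H (p i) ((q(k := d - 1)) j))"
        by (simp only: IH detn_transpose[where A = "\<lambda>i j. ?H' (p i) (q j)"]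
          detn_transpose[where A = "\<lambda>i j. ?H (p i) (q j)"]
          detn_transpose[where A = "\<lambda>i j. ?H (p i) ((q(k := d - 1)) j)"])
      show ?thesis
      proof (cases "k < N \<and> Suc (q (Suc k)) = d")
        case True
        have "?F' N p q = ?F N p q"
        proof (rule partial_schur_frob_none[OF p q])
          fix k' assume "k' \<in> {1..N}" "c = - int (q k')"
          then have "k' = k" using strict_dec_ne[OF q, of k' k] k d by auto
          then show "k' < N \<and> Suc (q (Suc k')) = q k'" using True k by simp
        qed (use d in auto)
        moreover have "detn N (\<lambda>i j. ?H (p i) ((q(k := d - 1)) j)) = 0"
          using detn_row_collision[of k N q d "\<lambda>b i. ?H (p i) b"] k True
            detn_transpose[of N "\<lambda>i j. ?H (p i) ((q(k := d - 1)) j)"] by simp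
        ultimately show ?thesis using det by simp
      next
        case False
        have "?F' N p q = ?F N p q + w n c * ?F N p (q(k := d - 1))"
          using partial_schur_frob_neg[OF p q n k(1)] False k d by auto
        moreover have "?F N p (q(k := d - 1)) = detn N (\<lambda>i j. ?H (p i) ((q(k := d - 1)) j))"
        proof (rule giambelliD[OF G p])
          show "strict_dec N (q(k := d - 1))"
            using strict_dec_decrement[OF q k(1)] False k d by auto
        qed (use K k in \<open>auto intro: le_trans[OF diff_le_self]\<close>)
        ultimately show ?thesis using det by simp
      qed
    next
      case False
      have "?F' N p q = ?F N p q"
        using False d by (intro partial_schur_frob_none[OF p q]) auto
      then show ?thesis by (rule cong) (use False in \<open>subst hook, auto\<close>)
    qed
  next
    case 3
    have hook: "?H' a b = ?H a b + (if a = 0 \<and> b = 0 then w n c else 0)" for a b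
      unfolding hook using 3 by auto
    show ?thesis
    proof (cases "1 \<le> N \<and> p N = 0 \<and> q N = 0")
      case True
      then obtain N' where N: "N = Suc N'" by (cases N) auto
      have z: "p i = 0 \<longleftrightarrow> i = N" "q i = 0 \<longleftrightarrow> i = N" if "i \<in> {1..N}" for i
        using True strict_dec_ne[OF p that, of N] strict_dec_ne[OF q that, of N] by (cases "i = N"; auto)+
      \<comment> \<open>Only the entry \<open>(N, N)\<close> changes, so the correction to row
        \<open>N\<close> is a unit vector; \<open>?E\<close> holds that vector in row
        \<open>N\<close> and therefore reduces to size \<open>N'\<close>.\<close>
      let ?E = "\<lambda>i j. if i = N then of_bool (j = N) else ?H' (p i) (q j)"
      have "detn N (\<lambda>i j. ?H' (p i) (q j)) = detn N (\<lambda>i j. ?H (p i) (q j)) + w n c * detn N ?E"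
        by (rule detn_row_add[where k = N]) (use N in \<open>simp_all add: hook z\<close>)
      also have "detn N ?E = detn N' ?E"
        unfolding N by (rule detn_last_row_unit) auto
      also have "\<dots> = detn N' (\<lambda>i j. ?H (p i) (q j))"
        by (rule detn_cong) (use N in \<open>simp add: hook z\<close>)
      also have "\<dots> = ?F N' p q"
        by (rule giambelliD[OF G, symmetric]) (use p q K N in \<open>auto simp: strict_dec_def\<close>)
      finally show ?thesis
        using partial_schur_frob_zero[of N' p q n w] p q n True N 3 IH by simp
    next
      case False
      \<comment> \<open>Strict decrease places a coordinate 0 at index \<open>N\<close> only, so an
        affected entry could only be \<open>(N, N)\<close>.\<close>
      have "\<not> (p i = 0 \<and> q j = 0)" if ij: "i \<in> {1..N}" "j \<in> {1..N}" for i j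
      proof
        assume z: "p i = 0 \<and> q j = 0"
        then have "i = N" "j = N"
          using strict_decD[OF p, of i N] strict_decD[OF q, of j N] ij by fastforce+
        then show False using z False ij by auto
      qed
      then have h: "?H' (p i) (q j) = ?H (p i) (q j)" if "i \<in> {1..N}" "j \<in> {1..N}" for i j
        using that by (simp only: hook) simp
      have "?F' N p q = ?F N p q"
        using False 3 by (intro partial_schur_frob_none[OF p q]) auto
      then show ?thesis by (rule cong) (rule h)
    qed
  qed
qed

lemma giambelli_steps:
  assumes "giambelli w K n c" "1 \<le> n"
  shows "giambelli w K n (c + int k)"
proof (induction k)
  case (Suc k)
  then show ?case using giambelli_step[OF _ assms(2), of w K "c + int k"] by (simp add: ac_simps)
qed (use assms in simp)

lemma frob_content_bound:
  assumes "\<And>i. i \<in> {1..N} \<Longrightarrow> p i \<le> K \<and> q i \<le> K" "b \<in> frob_diagram N p q"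
  shows "- int K \<le> content b" "content b \<le> int K"
  using assms(2) assms(1)[of "fst b"] assms(1)[of "snd b"]
  by (auto simp: frob_diagram_def content_def)

text \<open>Induction on the entry value. Contents lie in \<open>-K..K\<close>, so the thresholds
  \<open>(n, K + 1)\<close> and \<open>(n + 1, -K)\<close> admit the same tableaux, and steps
  through the contents lead from one value to the next.\<close>

lemma giambelli_all:
  "giambelli w K (Suc n) (- int K)"
proof (induction n)
  case 0
  \<comment> \<open>Base case: the entry at \<open>(1, 1)\<close> is at least 1 and its content 0 is
    not below \<open>- int K\<close>, so no tableau of a nonempty shape qualifies.\<close>
  have "tableaux_below 1 (- int K) (frob_diagram N p q) = {}"
    if K: "\<forall>i\<in>{1..N}. p i \<le> K \<and> q i \<le> K" and N: "1 \<le> N" for N p q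
  proof -
    have b: "(1, 1) \<in> frob_diagram N p q" using N by (auto simp: frob_diagram_def)
    have "- int K \<le> content (1, 1)" by simp
    then show ?thesis using b by (fastforce simp: tableaux_below_def tableaux_def)
  qed
  then have zero: "partial_schur w 1 (- int K) (frob_diagram N p q) = 0"
    if K: "\<forall>i\<in>{1..N}. p i \<le> K \<and> q i \<le> K" and N: "1 \<le> N" for N p q
    using that by (simp add: partial_schur_def)
  show ?case
    unfolding giambelli_def
  proof (intro allI impI, elim conjE)
    fix N p q
    assume p: "strict_dec N p" and q: "strict_dec N q" and K: "\<forall>i\<in>{1..N}. p i \<le> K \<and> q i \<le> K"
    show "partial_schur w (Suc 0) (- int K) (frob_diagram N p q) =
      detn N (\<lambda>i j. partial_schur w (Suc 0) (- int K) (hook (p i) (q j)))"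
    proof (cases "N = 0")
      case False
      have "detn N (\<lambda>i j. partial_schur w 1 (- int K) (hook (p i) (q j))) = detn N (\<lambda>i j. 0)"
        using K by (intro detn_cong zero) auto
      also have "\<dots> = 0" using False by (simp add: detn_def power_0_left)
      finally show ?thesis using zero[OF K] False by simp
    qed simp
  qed
next
  case (Suc n)
  \<comment> \<open>There are \<open>2 * K + 1\<close> contents from \<open>-K\<close> to
    \<open>K\<close>, hence that many steps.\<close>
  have G: "giambelli w K (Suc n) (int K + 1)"
    using giambelli_steps[OF Suc.IH, of "Suc (2 * K)"] by (simp add: algebra_simps)
  have eq: "partial_schur w (Suc (Suc n)) (- int K) (frob_diagram N p q) =
    partial_schur w (Suc n) (int K + 1) (frob_diagram N p q)"
    if "\<And>i. i \<in> {1..N} \<Longrightarrow> p i \<le> K \<and> q i \<le> K" for N p q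
  proof -
    have "tableaux_below (Suc (Suc n)) (- int K) (frob_diagram N p q) =
      tableaux_below (Suc n) (int K + 1) (frob_diagram N p q)"
      unfolding tableaux_below_def
    proof (intro Collect_cong conj_cong ball_cong refl)
      fix M b assume b: "b \<in> frob_diagram N p q"
      then have "- int K \<le> content b" using that by (intro frob_content_bound(1))
      moreover have "content b \<le> int K" using b that by (intro frob_content_bound(2))
      ultimately show "(M b < Suc (Suc n) \<or> M b = Suc (Suc n) \<and> content b < - int K) \<longleftrightarrow>
        M b < Suc n \<or> M b = Suc n \<and> content b < int K + 1" by linarith
    qed
    then show ?thesis by (simp add: partial_schur_def)
  qed
  show ?case
    unfolding giambelli_def
  proof (intro allI impI, elim conjE)
    fix N p q
    assume p: "strict_dec N p" and q: "strict_dec N q" and K: "\<forall>i\<in>{1..N}. p i \<le> K \<and> q i \<le> K"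
    have "detn N (\<lambda>i j. partial_schur w (Suc (Suc n)) (- int K) (hook (p i) (q j))) =
      detn N (\<lambda>i j. partial_schur w (Suc n) (int K + 1) (hook (p i) (q j)))"
      using K by (intro detn_cong eq) auto
    then show "partial_schur w (Suc (Suc n)) (- int K) (frob_diagram N p q) =
      detn N (\<lambda>i j. partial_schur w (Suc (Suc n)) (- int K) (hook (p i) (q j)))"
      using eq[of N p q] giambelliD[OF G p q] K by simp
  qed
qed

section \<open>Giambelli's formula for entries at most \<open>n\<close>\<close>

definition bounded_tableaux :: "nat \<Rightarrow> (nat \<times> nat) set \<Rightarrow> (nat \<times> nat \<Rightarrow> nat) set" where
  "bounded_tableaux n D = {M \<in> tableaux D. \<forall>b\<in>D. M b \<le> n}"

text \<open>Under the threshold \<open>(n + 1, -K)\<close> with \<open>K\<close> bounding all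
  coordinates, no content is below \<open>-K\<close>, so the condition is just
  \<open>M b <= n\<close>.\<close>

lemma bounded_tableaux_giambelli:
  fixes w :: "nat \<Rightarrow> int \<Rightarrow> complex"
  assumes p: "strict_dec N p" and q: "strict_dec N q"
  shows "(\<Sum>M\<in>bounded_tableaux n (frob_diagram N p q). \<Prod>b\<in>frob_diagram N p q. w (M b) (content b)) =
    detn N (\<lambda>i j. \<Sum>M\<in>bounded_tableaux n (hook (p i) (q j)). \<Prod>b\<in>hook (p i) (q j). w (M b) (content b))"
proof -
  \<comment> \<open>The largest coordinate; inserting 0 keeps the maximum meaningful for
    \<open>N = 0\<close>.\<close>
  define K where "K = Max (insert 0 (p ` {1..N} \<union> q ` {1..N}))"
  have K: "p i \<le> K \<and> q i \<le> K" if "i \<in> {1..N}" for i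
    using that by (auto simp: K_def intro!: Max_ge)
  have eq: "partial_schur w (Suc n) (- int K) (frob_diagram N p q) =
      (\<Sum>M\<in>bounded_tableaux n (frob_diagram N p q). \<Prod>b\<in>frob_diagram N p q. w (M b) (content b))"
    if "\<And>i. i \<in> {1..N} \<Longrightarrow> p i \<le> K \<and> q i \<le> K" for N p q
  proof -
    have "tableaux_below (Suc n) (- int K) (frob_diagram N p q) = bounded_tableaux n (frob_diagram N p q)"
      unfolding tableaux_below_def bounded_tableaux_def
    proof (intro Collect_cong conj_cong ball_cong refl)
      fix M b assume "b \<in> frob_diagram N p q"
      then have "- int K \<le> content b" using that by (intro frob_content_bound(1))
      then show "(M b < Suc n \<or> M b = Suc n \<and> content b < - int K) \<longleftrightarrow> M b \<le> n" by linarith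
    qed
    then show ?thesis by (simp add: partial_schur_def)
  qed
  have F: "partial_schur w (Suc n) (- int K) (frob_diagram N p q) =
    detn N (\<lambda>i j. partial_schur w (Suc n) (- int K) (hook (p i) (q j)))"
    by (rule giambelliD[OF giambelli_all p q]) (rule K)
  have "partial_schur w (Suc n) (- int K) (frob_diagram N p q) =
      (\<Sum>M\<in>bounded_tableaux n (frob_diagram N p q). \<Prod>b\<in>frob_diagram N p q. w (M b) (content b))"
    by (rule eq) (rule K)
  moreover have "detn N (\<lambda>i j. partial_schur w (Suc n) (- int K) (hook (p i) (q j))) =
    detn N (\<lambda>i j. \<Sum>M\<in>bounded_tableaux n (hook (p i) (q j)). \<Prod>b\<in>hook (p i) (q j). w (M b) (content b))"
  proof (rule detn_cong)
    fix i j assume "i \<in> {1..N}" "j \<in> {1..N}"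
    then show "partial_schur w (Suc n) (- int K) (hook (p i) (q j)) =
      (\<Sum>M\<in>bounded_tableaux n (hook (p i) (q j)). \<Prod>b\<in>hook (p i) (q j). w (M b) (content b))"
      using K by (intro eq) auto
  qed
  ultimately show ?thesis using F by metis
qed

section \<open>Convergence\<close>

text \<open>Summability of complex families is absolute, so the sum over the product set can be
  evaluated one factor at a time.\<close>

lemma has_sum_product:
  fixes f :: "'a \<Rightarrow> complex" and g :: "'b \<Rightarrow> complex"
  assumes f: "(f has_sum S) A" and g: "(g has_sum T) B"
  shows "((\<lambda>(x, y). f x * g y) has_sum (S * T)) (A \<times> B)"
proof -
  have fa: "(\<lambda>x. norm (f x)) summable_on A" and ga: "(\<lambda>y. norm (g y)) summable_on B"
    using f g by (metis summable_on_iff_abs_summable_on_complex has_sum_imp_summable)+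
  have "(\<lambda>w. norm (case w of (x, y) \<Rightarrow> f x * g y)) summable_on (A \<times> B)"
    unfolding Infinite_Sum.abs_summable_on_Sigma_iff
    using fa ga by (auto simp: norm_mult infsum_cmult_right' abs_mult
      intro!: summable_on_cmult_left summable_on_cmult_right)
  then have s: "(\<lambda>(x, y). f x * g y) summable_on (A \<times> B)"
    by (rule abs_summable_summable)
  show ?thesis
  proof (rule has_sum_SigmaI[OF _ _ s])
    show "((\<lambda>y. case (x, y) of (x, y) \<Rightarrow> f x * g y) has_sum f x * T) B" for x
      using has_sum_cmult_right[OF g] by simp
    show "((\<lambda>x. f x * T) has_sum S * T) A"
      by (rule has_sum_cmult_left[OF f])
  qed
qed

definition pos_funs :: "'a set \<Rightarrow> ('a \<Rightarrow> nat) set" where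
  "pos_funs A = {g. (\<forall>x\<in>A. 1 \<le> g x) \<and> (\<forall>x. x \<notin> A \<longrightarrow> g x = 0)}"

lemma has_sum_prod_pos_funs:
  fixes f :: "'a \<Rightarrow> nat \<Rightarrow> complex"
  assumes "finite A" "\<And>x. x \<in> A \<Longrightarrow> (f x has_sum S x) {1..}"
  shows "((\<lambda>g. \<Prod>x\<in>A. f x (g x)) has_sum (\<Prod>x\<in>A. S x)) (pos_funs A)"
  using assms
proof (induction A rule: finite_induct)
  case empty
  have "pos_funs {} = {\<lambda>_::'a. 0}" by (auto simp: pos_funs_def)
  then show ?case using has_sum_finite[of "{\<lambda>_::'a. 0::nat}" "\<lambda>_. 1::complex"] by simp
next
  case (insert x A)
  have "((\<lambda>(m, g). f x m * (\<Prod>y\<in>A. f y (g y))) has_sum (S x * (\<Prod>y\<in>A. S y))) ({1..} \<times> pos_funs A)"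
    using insert by (intro has_sum_product) auto
  also have "?this \<longleftrightarrow> ((\<lambda>g. \<Prod>y\<in>insert x A. f y (g y)) has_sum (S x * (\<Prod>y\<in>A. S y))) (pos_funs (insert x A))"
  proof (rule has_sum_reindex_bij_witness[where i = "\<lambda>g. (g x, g(x := 0))" and j = "\<lambda>w. (snd w)(x := fst w)"])
    fix g assume "g \<in> {1::nat..} \<times> pos_funs A"
    then obtain m g' where g: "g = (m, g')" "1 \<le> m" "g' \<in> pos_funs A" by auto
    then have z: "g' x = 0" using insert by (simp add: pos_funs_def)
    show "(\<lambda>g. (g x, g(x := 0))) ((snd g)(x := fst g)) = g"
      using g z by (simp add: fun_upd_idem)
    show "(snd g)(x := fst g) \<in> pos_funs (insert x A)"
      using g by (simp add: pos_funs_def)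
    show "(\<Prod>y\<in>insert x A. f y (((snd g)(x := fst g)) y)) =
      (case g of (m, g) \<Rightarrow> f x m * (\<Prod>y\<in>A. f y (g y)))"
      using insert.hyps g by (auto intro!: prod.cong)
  next
    fix g assume "g \<in> pos_funs (insert x A)"
    then show "(g x, g(x := 0)) \<in> {1..} \<times> pos_funs A"
      using insert.hyps by (auto simp: pos_funs_def)
  qed (use insert in auto)
  finally show ?case using insert.hyps by simp
qed

section \<open>Absolute convergence of the sum over all tableaux\<close>

definition tab_weight :: "(int \<Rightarrow> complex) \<Rightarrow> (nat \<times> nat) set \<Rightarrow> (nat \<times> nat \<Rightarrow> nat) \<Rightarrow> complex" where
  "tab_weight z D M = (\<Prod>b\<in>D. of_nat (M b) powr (- z (content b)))"

lemma norm_of_nat_powr: "norm ((of_nat n :: complex) powr s) = real n powr Re s"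
  using norm_powr_real_powr[of "of_nat n" s] by simp

lemma has_sum_zeta:
  assumes "1 < Re s"
  shows "\<exists>S. ((\<lambda>m::nat. (of_nat m :: complex) powr (- s)) has_sum S) {1..}"
proof -
  have "summable (\<lambda>m::nat. norm ((of_nat m :: complex) powr (- s)))"
    using assms by (simp add: norm_of_nat_powr summable_real_powr_iff)
  then have "(\<lambda>m::nat. (of_nat m :: complex) powr (- s)) summable_on UNIV"
    by (rule norm_summable_imp_summable_on)
  then show ?thesis
    by (meson summable_on_subset_banach subset_UNIV summable_on_def)
qed

text \<open>Among the boxes with the largest entry, take one with \<open>i + j\<close> maximal: the
  box below would exceed the maximum, and the box to the right would attain it with larger
  \<open>i + j\<close>.\<close>

lemma tableau_max_corner:
  assumes "finite D" "D \<noteq> {}" and M: "M \<in> tableaux D"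
  obtains b where "corner D b" "\<And>b'. b' \<in> D \<Longrightarrow> M b' \<le> M b"
proof -
  define m where "m = Max (M ` D)"
  have le: "M b' \<le> m" if "b' \<in> D" for b'
    using that assms by (simp add: m_def)
  have "m \<in> M ` D" unfolding m_def using assms by (intro Max_in) auto
  define E where "E = {b\<in>D. M b = m}"
  have E: "finite E" "E \<noteq> {}" using assms \<open>m \<in> M ` D\<close> by (auto simp: E_def)
  define t where "t = Max ((\<lambda>b. fst b + snd b) ` E)"
  have tle: "fst b + snd b \<le> t" if "b \<in> E" for b
    using that E by (simp add: t_def)
  have "t \<in> (\<lambda>b. fst b + snd b) ` E" unfolding t_def using E by (intro Max_in) auto
  then obtain i j where b: "(i, j) \<in> E" "t = i + j" by auto
  have D: "(i, j) \<in> D" "M (i, j) = m" using b by (auto simp: E_def)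
  have "(Suc i, j) \<notin> D"
  proof
    assume a: "(Suc i, j) \<in> D"
    then have "M (i, j) < M (Suc i, j)" using M D unfolding tableaux_def by blast
    then show False using le[OF a] D by simp
  qed
  moreover have "(i, Suc j) \<notin> D"
  proof
    assume a: "(i, Suc j) \<in> D"
    then have "M (i, j) \<le> M (i, Suc j)" using M D unfolding tableaux_def by blast
    then have "(i, Suc j) \<in> E" using le[OF a] D a by (simp add: E_def)
    then show False using tle b by fastforce
  qed
  ultimately have "corner D (i, j)" using D by (simp add: corner_def)
  then show thesis using that[of "(i, j)"] le D by simp
qed

text \<open>With \<open>b0\<close> a corner holding the largest entry, the norm of the weight is at
  most \<open>M b0\<close> to the power \<open>-\<epsilon>\<close> times the product of all
  \<open>1 / M b\<close>. Spreading the first factor over the boxes gives a bound by a product of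
  terms of convergent zeta series with exponent \<open>1 + \<delta>\<close>.\<close>

lemma tab_weight_summable:
  assumes fin: "finite D" and ge: "\<And>b. b \<in> D \<Longrightarrow> 1 \<le> Re (z (content b))"
    and gt: "\<And>b. corner D b \<Longrightarrow> 1 < Re (z (content b))"
  shows "tab_weight z D summable_on tableaux D"
proof (cases "D = {}")
  case True
  have "tableaux {} = {\<lambda>_. 0}" by (auto simp: tableaux_def)
  then show ?thesis using True by simp
next
  case False
  \<comment> \<open>\<open>\<epsilon>\<close> will be the least surplus of an exponent over 1 among
    the corners, capped at 1 so that the minimum runs over a nonempty set.\<close>
  define E where "E = insert 1 ((\<lambda>b. Re (z (content b)) - 1) ` {b. corner D b})"
  define \<epsilon> where "\<epsilon> = Min E"
  define \<delta> where "\<delta> = \<epsilon> / card D"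
  have "{b. corner D b} \<subseteq> D" by (auto simp: corner_def)
  then have finE: "finite E" using fin finite_subset by (auto simp: E_def)
  have "\<epsilon> > 0" unfolding \<epsilon>_def using finE gt by (subst Min_gr_iff) (auto simp: E_def)
  then have \<delta>: "\<delta> > 0" "\<delta> * card D = \<epsilon>" using fin False by (auto simp: \<delta>_def card_gt_0_iff)
  have \<epsilon>_le: "1 + \<epsilon> \<le> Re (z (content b))" if "corner D b" for b
    using Min_le[OF finE, of "Re (z (content b)) - 1"] that by (auto simp: E_def \<epsilon>_def)
  let ?g = "\<lambda>M. \<Prod>b\<in>D. (of_nat (M b) :: complex) powr (- complex_of_real (1 + \<delta>))"
  obtain S where "((\<lambda>m::nat. (of_nat m :: complex) powr (- complex_of_real (1 + \<delta>))) has_sum S) {1..}"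
    using has_sum_zeta[of "complex_of_real (1 + \<delta>)"] \<delta> by auto
  then have "?g summable_on pos_funs D"
    using has_sum_prod_pos_funs[OF fin] by (meson summable_on_def)
  moreover have "tableaux D \<subseteq> pos_funs D" by (auto simp: tableaux_def pos_funs_def)
  ultimately have "?g summable_on tableaux D" by (rule summable_on_subset_banach)
  then have g: "(\<lambda>M. norm (?g M)) summable_on tableaux D" by (simp only: summable_on_iff_abs_summable_on_complex)
  have "(\<lambda>M. norm (tab_weight z D M)) summable_on tableaux D"
  proof (rule Infinite_Sum.abs_summable_on_comparison_test[OF g])
    fix M assume M: "M \<in> tableaux D"
    then have pos: "1 \<le> M b" if "b \<in> D" for b using that by (auto simp: tableaux_def)
    obtain b0 where b0: "corner D b0" and max: "\<And>b. b \<in> D \<Longrightarrow> M b \<le> M b0"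
      using tableau_max_corner[OF fin False M] by blast
    have b0D: "b0 \<in> D" using b0 by (simp add: corner_def)
    have "(\<Prod>b\<in>D. real (M b) powr (- Re (z (content b)))) =
      real (M b0) powr (- Re (z (content b0))) * (\<Prod>b\<in>D - {b0}. real (M b) powr (- Re (z (content b))))"
      by (rule prod.remove[OF fin b0D])
    also have "\<dots> \<le> real (M b0) powr (- 1 - \<epsilon>) * (\<Prod>b\<in>D - {b0}. real (M b) powr (- 1))"
      using pos b0D ge \<epsilon>_le[OF b0]
      by (intro mult_mono prod_mono powr_mono conjI prod_nonneg) fastforce+
    also have "\<dots> = real (M b0) powr (- \<epsilon>) * (real (M b0) powr (- 1) * (\<Prod>b\<in>D - {b0}. real (M b) powr (- 1)))"
      by (simp only: diff_conv_add_uminus powr_add mult_ac)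
    also have "\<dots> = real (M b0) powr (- \<epsilon>) * (\<Prod>b\<in>D. real (M b) powr (- 1))"
      by (simp only: prod.remove[OF fin b0D])
    \<comment> \<open>Since \<open>\<delta> * card D = \<epsilon>\<close>, each box receives the
      exponent \<open>-\<delta>\<close>; replacing \<open>M b0\<close> by the smaller or equal
      \<open>M b\<close> can only enlarge the product.\<close>
    also have "real (M b0) powr (- \<epsilon>) = (\<Prod>b\<in>D. real (M b0) powr (- \<delta>))"
      using pos[OF b0D] \<delta>(2) by (simp add: powr_powr flip: powr_realpow)
    also have "\<dots> \<le> (\<Prod>b\<in>D. real (M b) powr (- \<delta>))"
      using pos max \<delta> by (intro prod_mono conjI powr_mono2') (auto simp: Suc_le_eq)
    finally have "(\<Prod>b\<in>D. real (M b) powr (- Re (z (content b)))) \<le>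
      (\<Prod>b\<in>D. real (M b) powr (- \<delta>)) * (\<Prod>b\<in>D. real (M b) powr (- 1))"
      by (simp add: mult_right_mono prod_nonneg)
    also have "\<dots> = (\<Prod>b\<in>D. real (M b) powr (- (1 + \<delta>)))"
      unfolding prod.distrib[symmetric] powr_add[symmetric] by (simp add: add.commute)
    finally show "norm (tab_weight z D M) \<le> norm (?g M)"
      by (simp add: tab_weight_def norm_of_nat_powr flip: prod_norm)
  qed
  then show ?thesis by (rule abs_summable_summable)
qed

text \<open>Every finite set of tableaux has a bound on its entries, so the finite sets
  \<open>bounded_tableaux n D\<close> eventually lie above it in the net defining
  \<open>infsum\<close>.\<close>

lemma bounded_tableaux_tendsto:
  fixes f :: "(nat \<times> nat \<Rightarrow> nat) \<Rightarrow> complex"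
  assumes fin: "finite D" and f: "f summable_on tableaux D"
  shows "(\<lambda>n. \<Sum>M\<in>bounded_tableaux n D. f M) \<longlonglongrightarrow> infsum f (tableaux D)"
proof -
  have finb: "finite (bounded_tableaux n D)" for n
  proof (rule finite_subset)
    show "bounded_tableaux n D \<subseteq> {M. \<forall>b. (b \<in> D \<longrightarrow> M b \<in> {..n}) \<and> (b \<notin> D \<longrightarrow> M b = 0)}"
      by (auto simp: bounded_tableaux_def tableaux_def)
  qed (rule finite_set_of_finite_funs[OF fin finite_atMost])
  have "filterlim (\<lambda>n. bounded_tableaux n D) (finite_subsets_at_top (tableaux D)) sequentially"
    unfolding filterlim_finite_subsets_at_top
  proof (intro allI impI, elim conjE)
    fix X assume X: "finite X" "X \<subseteq> tableaux D"
    define n0 where "n0 = Max (insert 0 ((\<lambda>(M, b). M b) ` (X \<times> D)))"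
    have n0: "M b \<le> n0" if "M \<in> X" "b \<in> D" for M b
      unfolding n0_def using X fin that by (intro Max_ge) force+
    have "finite (bounded_tableaux n D) \<and> X \<subseteq> bounded_tableaux n D \<and> bounded_tableaux n D \<subseteq> tableaux D"
      if "n0 \<le> n" for n
    proof (intro conjI)
      show "X \<subseteq> bounded_tableaux n D"
        using X n0 that order_trans unfolding bounded_tableaux_def by blast
    qed (use finb in \<open>auto simp: bounded_tableaux_def\<close>)
    then show "\<forall>\<^sub>F n in sequentially. finite (bounded_tableaux n D) \<and> X \<subseteq> bounded_tableaux n D \<and>
        bounded_tableaux n D \<subseteq> tableaux D"
      by (rule eventually_sequentiallyI)
  qed
  moreover have "(sum f \<longlongrightarrow> infsum f (tableaux D)) (finite_subsets_at_top (tableaux D))"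
    using has_sum_infsum[OF f] by (simp only: has_sum_def)
  ultimately show ?thesis by (rule filterlim_compose[rotated])
qed

text \<open>This is why real parts above 1 are demanded only at contents \<open>p i\<close> and
  \<open>- q i\<close>: no corner has any other content.\<close>

lemma corner_frob_content:
  assumes p: "strict_dec N p" and q: "strict_dec N q" and b: "corner (frob_diagram N p q) b"
  shows "\<exists>i\<in>{1..N}. content b = int (p i) \<or> content b = - int (q i)"
proof -
  obtain i j where e: "b = (i, j)" by fastforce
  consider "i < j" | "j < i" | "i = j" by linarith
  then show ?thesis
  proof cases
    case 1
    then show ?thesis using b e corner_frob_pos_iff[OF p 1, of q] by (intro bexI[of _ i]) auto
  next
    case 2
    then show ?thesis using b e corner_frob_neg_iff[OF q 2, of p] by (intro bexI[of _ j]) auto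
  next
    case 3
    then show ?thesis using b e corner_frob_zero_iff[OF p q, of i] by (intro bexI[of _ N]) auto
  qed
qed

lemma tab_weight_frob_summable:
  assumes p: "strict_dec N p" and q: "strict_dec N q"
    and ge: "\<And>b. b \<in> frob_diagram N p q \<Longrightarrow> 1 \<le> Re (z (content b))"
    and gt: "\<And>i. i \<in> {1..N} \<Longrightarrow> 1 < Re (z (int (p i))) \<and> 1 < Re (z (- int (q i)))"
  shows "tab_weight z (frob_diagram N p q) summable_on tableaux (frob_diagram N p q)"
proof (rule tab_weight_summable)
  show "finite (frob_diagram N p q)" using young_frob_diagram[OF p q] unfolding young_def by blast
  show "1 \<le> Re (z (content b))" if "b \<in> frob_diagram N p q" for b
    using ge that .
  show "1 < Re (z (content b))" if "corner (frob_diagram N p q) b" for b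
    using corner_frob_content[OF p q that] gt by auto
qed

text \<open>The hook with arm \<open>p i\<close> and leg \<open>q j\<close> may mix two diagonal
  boxes, but its contents already occur in the shape: those of the arm in row \<open>i\<close>,
  those of the leg in column \<open>j\<close>.\<close>

lemma hook_content_ge:
  assumes ge: "\<And>b. b \<in> frob_diagram N p q \<Longrightarrow> 1 \<le> Re (z (content b))"
    and ij: "i \<in> {1..N}" "j \<in> {1..N}" and b: "b \<in> hook (p i) (q j)"
  shows "1 \<le> Re (z (content b))"
proof -
  obtain k l where e: "b = (k, l)" by fastforce
  show ?thesis
  proof (cases "k \<le> l")
    case True
    then have "(i, i + (l - k)) \<in> frob_diagram N p q"
      using b e ij by (auto simp: frob_diagram_def)
    then show ?thesis using ge[of "(i, i + (l - k))"] True e by (simp add: of_nat_diff)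
  next
    case False
    then have "(j + (k - l), j) \<in> frob_diagram N p q"
      using b e ij by (auto simp: frob_diagram_def)
    then show ?thesis using ge[of "(j + (k - l), j)"] False e by (simp add: of_nat_diff)
  qed
qed

text \<open>A determinant is a polynomial in its entries, so the identity for entries at most
  \<open>n\<close> passes to the limit entrywise.\<close>

lemma giambelli_infsum:
  assumes p: "strict_dec N p" and q: "strict_dec N q"
    and ge: "\<And>b. b \<in> frob_diagram N p q \<Longrightarrow> 1 \<le> Re (z (content b))"
    and gt: "\<And>i. i \<in> {1..N} \<Longrightarrow> 1 < Re (z (int (p i))) \<and> 1 < Re (z (- int (q i)))"
  shows "infsum (tab_weight z (frob_diagram N p q)) (tableaux (frob_diagram N p q)) =
    detn N (\<lambda>i j. infsum (tab_weight z (hook (p i) (q j))) (tableaux (hook (p i) (q j))))"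
proof (rule LIMSEQ_unique)
  let ?T = "\<lambda>n D. \<Sum>M\<in>bounded_tableaux n D. tab_weight z D M"
  have fin: "finite (frob_diagram N p q)" if "strict_dec N p" "strict_dec N q" for N p q
    using young_frob_diagram[OF that] unfolding young_def by blast
  show "(\<lambda>n. ?T n (frob_diagram N p q)) \<longlonglongrightarrow>
      infsum (tab_weight z (frob_diagram N p q)) (tableaux (frob_diagram N p q))"
    by (intro bounded_tableaux_tendsto fin p q tab_weight_frob_summable[OF p q ge gt])
  have "(\<lambda>n. ?T n (hook (p i) (q j))) \<longlonglongrightarrow> infsum (tab_weight z (hook (p i) (q j))) (tableaux (hook (p i) (q j)))"
    if "i \<in> {1..N}" "j \<in> {1..N}" for i j
    using gt[OF that(1)] gt[OF that(2)] hook_content_ge[where z = z, OF ge that]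
    by (intro bounded_tableaux_tendsto fin tab_weight_frob_summable) auto
  then have "(\<lambda>n. detn N (\<lambda>i j. ?T n (hook (p i) (q j)))) \<longlonglongrightarrow>
    detn N (\<lambda>i j. infsum (tab_weight z (hook (p i) (q j))) (tableaux (hook (p i) (q j))))"
    unfolding detn_def
    by (intro tendsto_sum tendsto_mult tendsto_const tendsto_prod) (use permutes_in_image in fastforce)
  moreover have "?T n (frob_diagram N p q) = detn N (\<lambda>i j. ?T n (hook (p i) (q j)))" for n
    unfolding tab_weight_def
    using bounded_tableaux_giambelli[OF p q, of "\<lambda>m c. of_nat m powr (- z c)" n] .
  ultimately show "(\<lambda>n. ?T n (frob_diagram N p q)) \<longlonglongrightarrow>
    detn N (\<lambda>i j. infsum (tab_weight z (hook (p i) (q j))) (tableaux (hook (p i) (q j))))"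
    by simp
qed

section \<open>Hooks\<close>

lemma mem_hook_iff:
  "(i, j) \<in> hook p q \<longleftrightarrow> i = 1 \<and> 1 \<le> j \<and> j \<le> Suc p \<or> j = 1 \<and> 1 \<le> i \<and> i \<le> Suc q"
  by (auto simp: frob_diagram_def)

lemma prod_hook:
  fixes f :: "nat \<times> nat \<Rightarrow> 'a::comm_monoid_mult"
  shows "prod f (hook p q) = f (1, 1) * ((\<Prod>j\<in>{1..p}. f (1, Suc j)) * (\<Prod>i\<in>{1..q}. f (Suc i, 1)))"
proof -
  let ?R = "(\<lambda>j. (1::nat, Suc j)) ` {1..p}" and ?C = "(\<lambda>i. (Suc i, 1::nat)) ` {1..q}"
  have "hook p q = insert (1, 1) (?R \<union> ?C)"
  proof (rule set_eqI, clarify)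
    fix i j
    show "(i, j) \<in> hook p q \<longleftrightarrow> (i, j) \<in> insert (1, 1) (?R \<union> ?C)"
      unfolding mem_hook_iff by (cases i; cases j) (auto simp: image_iff)
  qed
  moreover have "(1, 1) \<notin> ?R \<union> ?C" by auto
  moreover have "prod f (?R \<union> ?C) = prod f ?R * prod f ?C"
    by (intro prod.union_disjoint) auto
  moreover have "prod f ?R = (\<Prod>j\<in>{1..p}. f (1, Suc j))" "prod f ?C = (\<Prod>i\<in>{1..q}. f (Suc i, 1))"
    by (simp_all add: prod.reindex inj_on_def)
  ultimately show ?thesis by simp
qed

text \<open>Coordinates on hook tableaux: corner entry \<open>m\<close>, arm increments
  \<open>a\<close> (possibly 0, as rows increase weakly) and leg increments \<open>b\<close>
  (positive, as columns increase strictly). The increments are the summation variables of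
  \<open>zeta_bullet_H\<close> and \<open>zeta_H\<close>.\<close>

definition join_hook :: "nat \<Rightarrow> nat \<Rightarrow> nat \<times> (nat \<Rightarrow> nat) \<times> (nat \<Rightarrow> nat) \<Rightarrow> nat \<times> nat \<Rightarrow> nat" where
  "join_hook p q = (\<lambda>(m, a, b) (i, j). if (i, j) \<in> hook p q then
     if i = 1 then m + (\<Sum>k\<in>{1..j - 1}. a k) else m + (\<Sum>k\<in>{1..i - 1}. b k) else 0)"

definition split_hook :: "nat \<Rightarrow> nat \<Rightarrow> (nat \<times> nat \<Rightarrow> nat) \<Rightarrow> nat \<times> (nat \<Rightarrow> nat) \<times> (nat \<Rightarrow> nat)" where
  "split_hook p q M = (M (1, 1),
     \<lambda>k. if k \<in> {1..p} then M (1, Suc k) - M (1, k) else 0,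
     \<lambda>k. if k \<in> {1..q} then M (Suc k, 1) - M (k, 1) else 0)"

definition arm_funs :: "nat \<Rightarrow> (nat \<Rightarrow> nat) set" where
  "arm_funs p = {a. \<forall>i. i \<notin> {1..p} \<longrightarrow> a i = 0}"

text \<open>Monotonicity makes the truncated subtraction on \<open>nat\<close> exact.\<close>

lemma telescope_nat:
  fixes g :: "nat \<Rightarrow> nat"
  assumes "\<And>k. k \<in> {1..n} \<Longrightarrow> g k \<le> g (Suc k)"
  shows "g 1 + (\<Sum>k\<in>{1..n}. g (Suc k) - g k) = g (Suc n)"
  using assms
proof (induction n)
  case (Suc n)
  then have "g 1 + (\<Sum>k\<in>{1..n}. g (Suc k) - g k) = g (Suc n)" "g (Suc n) \<le> g (Suc (Suc n))" by auto
  then show ?case by simp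
qed simp

section \<open>Bijection between hook tableaux and their corner, arm and leg data\<close>

lemma join_hook_arm: "j \<le> p \<Longrightarrow> join_hook p q (m, a, b) (1, Suc j) = m + (\<Sum>k\<in>{1..j}. a k)"
  by (simp add: join_hook_def mem_hook_iff)

lemma join_hook_leg: "i \<le> q \<Longrightarrow> join_hook p q (m, a, b) (Suc i, 1) = m + (\<Sum>k\<in>{1..i}. b k)"
  by (simp add: join_hook_def mem_hook_iff)

lemma join_hook_tableau:
  assumes m: "1 \<le> m" and b: "b \<in> pos_funs {1..q}"
  shows "join_hook p q (m, a, b) \<in> tableaux (hook p q)"
proof -
  let ?M = "join_hook p q (m, a, b)"
  have pos: "1 \<le> ?M c" if "c \<in> hook p q" for c
    using that m by (cases c) (auto simp: join_hook_def)
  have zero: "?M c = 0" if "c \<notin> hook p q" for c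
    using that by (cases c) (auto simp: join_hook_def)
  have row: "?M (i, j) \<le> ?M (i, Suc j)" if d: "(i, j) \<in> hook p q" "(i, Suc j) \<in> hook p q" for i j
  proof -
    obtain j' where j: "j = Suc j'" "i = 1" "Suc j' \<le> p"
      using d unfolding mem_hook_iff by (cases j) auto
    show ?thesis
      using join_hook_arm[of j' p q m a b] join_hook_arm[of "Suc j'" p q m a b] j by simp
  qed
  have col: "?M (i, j) < ?M (Suc i, j)" if d: "(i, j) \<in> hook p q" "(Suc i, j) \<in> hook p q" for i j
  proof -
    obtain i' where i: "i = Suc i'" "j = 1" "Suc i' \<le> q"
      using d unfolding mem_hook_iff by (cases i) auto
    have "1 \<le> b (Suc i')" using b i by (auto simp: pos_funs_def)
    then show ?thesis
      using join_hook_leg[of i' q p m a b] join_hook_leg[of "Suc i'" q p m a b] i by simp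
  qed
  show ?thesis unfolding tableaux_def using pos zero row col by blast
qed

lemma split_join_hook:
  assumes "a \<in> arm_funs p" "b \<in> pos_funs {1..q}"
  shows "split_hook p q (join_hook p q (m, a, b)) = (m, a, b)"
proof -
  let ?M = "join_hook p q (m, a, b)"
  have "(if k \<in> {1..p} then ?M (1, Suc k) - ?M (1, k) else 0) = a k" for k
  proof (cases "k \<in> {1..p}")
    case True
    then obtain k' where "k = Suc k'" "Suc k' \<le> p" by (cases k) auto
    then show ?thesis using join_hook_arm[of k' p q m a b] join_hook_arm[of "Suc k'" p q m a b] by simp
  qed (use assms in \<open>auto simp: arm_funs_def\<close>)
  moreover have "(if k \<in> {1..q} then ?M (Suc k, 1) - ?M (k, 1) else 0) = b k" for k
  proof (cases "k \<in> {1..q}")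
    case True
    then obtain k' where "k = Suc k'" "Suc k' \<le> q" by (cases k) auto
    then show ?thesis using join_hook_leg[of k' q p m a b] join_hook_leg[of "Suc k'" q p m a b] by simp
  qed (use assms in \<open>auto simp: pos_funs_def\<close>)
  moreover have "?M (1, 1) = m" using join_hook_arm[of 0 p q m a b] by simp
  ultimately show ?thesis unfolding split_hook_def by presburger
qed

lemma hook_tableauD:
  assumes M: "M \<in> tableaux (hook p q)"
  shows "1 \<le> M (1, 1)"
    and "k \<in> {1..p} \<Longrightarrow> M (1, k) \<le> M (1, Suc k)"
    and "k \<in> {1..q} \<Longrightarrow> M (k, 1) < M (Suc k, 1)"
proof -
  have r: "(1, k) \<in> hook p q \<Longrightarrow> (1, Suc k) \<in> hook p q \<Longrightarrow> M (1, k) \<le> M (1, Suc k)"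
    and c: "(k, 1) \<in> hook p q \<Longrightarrow> (Suc k, 1) \<in> hook p q \<Longrightarrow> M (k, 1) < M (Suc k, 1)"
    and o: "(1, 1) \<in> hook p q \<Longrightarrow> 1 \<le> M (1, 1)"
    using M unfolding tableaux_def by blast+
  show "1 \<le> M (1, 1)" by (rule o) (simp add: mem_hook_iff)
  show "M (1, k) \<le> M (1, Suc k)" if "k \<in> {1..p}"
    by (rule r) (use that in \<open>simp_all add: mem_hook_iff\<close>)
  show "M (k, 1) < M (Suc k, 1)" if "k \<in> {1..q}"
    by (rule c) (use that in \<open>simp_all add: mem_hook_iff\<close>)
qed

lemma join_split_hook:
  assumes M: "M \<in> tableaux (hook p q)"
  shows "join_hook p q (split_hook p q M) = M"
proof
  fix c :: "nat \<times> nat"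
  obtain m a b where s: "split_hook p q M = (m, a, b)" by (cases "split_hook p q M")
  have m: "m = M (1, 1)"
    and a: "a = (\<lambda>k. if k \<in> {1..p} then M (1, Suc k) - M (1, k) else 0)"
    and b: "b = (\<lambda>k. if k \<in> {1..q} then M (Suc k, 1) - M (k, 1) else 0)"
    using s unfolding split_hook_def by auto
  have arm: "m + (\<Sum>k\<in>{1..j}. a k) = M (1, Suc j)" if "j \<le> p" for j
  proof -
    have "(\<Sum>k\<in>{1..j}. a k) = (\<Sum>k\<in>{1..j}. M (1, Suc k) - M (1, k))"
      using that by (intro sum.cong) (auto simp: a)
    then show ?thesis
      using telescope_nat[of j "\<lambda>k. M (1, k)"] hook_tableauD(2)[OF M] that m by simp
  qed
  have leg: "m + (\<Sum>k\<in>{1..i}. b k) = M (Suc i, 1)" if "i \<le> q" for i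
  proof -
    have "(\<Sum>k\<in>{1..i}. b k) = (\<Sum>k\<in>{1..i}. M (Suc k, 1) - M (k, 1))"
      using that by (intro sum.cong) (auto simp: b)
    then show ?thesis
      using telescope_nat[of i "\<lambda>k. M (k, 1)"] hook_tableauD(3)[OF M, THEN less_imp_le] that m by simp
  qed
  obtain i j where c: "c = (i, j)" by fastforce
  consider "c \<notin> hook p q" | j' where "i = 1" "j = Suc j'" "j' \<le> p" | i' where "j = 1" "i = Suc i'" "i' \<le> q"
    using mem_hook_iff[of i j p q] c by (cases i; cases j) auto
  then show "join_hook p q (split_hook p q M) c = M c"
  proof cases
    case 1
    then have "M c = 0" using M unfolding tableaux_def by blast
    then show ?thesis using 1 c s by (simp add: join_hook_def)
  next
    case 2
    then show ?thesis using join_hook_arm[of j' p q m a b] arm[of j'] c s by simp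
  next
    case 3
    then show ?thesis using join_hook_leg[of i' q p m a b] leg[of i'] c s by simp
  qed
qed

lemma split_hook_mem:
  assumes M: "M \<in> tableaux (hook p q)"
  shows "split_hook p q M \<in> {1..} \<times> arm_funs p \<times> pos_funs {1..q}"
proof -
  have "(\<lambda>k. if k \<in> {1..q} then M (Suc k, 1) - M (k, 1) else 0) \<in> pos_funs {1..q}"
    using hook_tableauD(3)[OF M] by (auto simp: pos_funs_def Suc_le_eq)
  then show ?thesis
    using hook_tableauD(1)[OF M] by (simp add: split_hook_def arm_funs_def)
qed

text \<open>Restrict to the slice at \<open>y\<close> and divide by \<open>g y\<close>. Convergence
  of the arm and leg sums is thereby read off from that of the hook sum.\<close>

lemma summable_on_product_fst:
  fixes f :: "'a \<Rightarrow> complex" and g :: "'b \<Rightarrow> complex"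
  assumes s: "(\<lambda>(x, y). f x * g y) summable_on (X \<times> Y)" and y: "y \<in> Y" "g y \<noteq> 0"
  shows "f summable_on X"
proof -
  have "(\<lambda>(x, y). f x * g y) summable_on (X \<times> {y})"
    by (rule summable_on_subset_banach[OF s]) (use y in auto)
  also have "?this \<longleftrightarrow> (\<lambda>x. f x * g y) summable_on X"
    by (rule summable_on_reindex_bij_witness[where i = "\<lambda>x. (x, y)" and j = fst]) auto
  finally show ?thesis using y by (simp add: summable_on_cmult_left')
qed

lemma summable_on_product_snd:
  fixes f :: "'a \<Rightarrow> complex" and g :: "'b \<Rightarrow> complex"
  assumes s: "(\<lambda>(x, y). f x * g y) summable_on (X \<times> Y)" and x: "x \<in> X" "f x \<noteq> 0"
  shows "g summable_on Y"
proof -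
  have "(\<lambda>(x, y). f x * g y) summable_on ({x} \<times> Y)"
    by (rule summable_on_subset_banach[OF s]) (use x in auto)
  also have "?this \<longleftrightarrow> (\<lambda>y. f x * g y) summable_on Y"
    by (rule summable_on_reindex_bij_witness[where i = "\<lambda>y. (x, y)" and j = snd]) auto
  finally show ?thesis using x by (simp add: summable_on_cmult_right')
qed

text \<open>The total weight of the hook tableaux with corner entry \<open>m\<close>; box
  \<open>(1, 1 + j)\<close> has content \<open>j\<close> and box \<open>(1 + l, 1)\<close> content
  \<open>-l\<close>.\<close>

definition hook_term :: "(int \<Rightarrow> complex) \<Rightarrow> nat \<Rightarrow> nat \<Rightarrow> nat \<Rightarrow> complex" where
  "hook_term z p q m = of_nat m powr (- z 0) *
     (zeta_bullet_H p (\<lambda>j. z (int j)) (real m) * zeta_H q (\<lambda>l. z (- int l)) (real m))"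

text \<open>Once the corner entry is fixed, arm and leg vary independently, so the inner sum
  factorises; summing over \<open>m\<close> gives back the hook.\<close>

lemma hook_has_sum:
  assumes s: "tab_weight z (hook p q) summable_on tableaux (hook p q)"
  shows "(hook_term z p q has_sum infsum (tab_weight z (hook p q)) (tableaux (hook p q))) {1..}"
proof -
  define A where "A m a = (\<Prod>j\<in>{1..p}. complex_of_real (real m + real (\<Sum>i\<in>{1..j}. a i)) powr (- z (int j)))"
    for m and a :: "nat \<Rightarrow> nat"
  define B where "B m b = (\<Prod>j\<in>{1..q}. complex_of_real (real m + real (\<Sum>i\<in>{1..j}. b i)) powr (- z (- int j)))"
    for m and b :: "nat \<Rightarrow> nat"
  define F where "F = (\<lambda>(m :: nat, a, b). (of_nat m :: complex) powr (- z 0) * (A m a * B m b))"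
  let ?H = "infsum (tab_weight z (hook p q)) (tableaux (hook p q))"
  let ?P = "{1::nat..} \<times> arm_funs p \<times> pos_funs {1..q}"
  have weight: "tab_weight z (hook p q) (join_hook p q (m, a, b)) = F (m, a, b)" for m a b
  proof -
    have "tab_weight z (hook p q) (join_hook p q (m, a, b)) =
      of_nat m powr (- z 0) *
      ((\<Prod>j\<in>{1..p}. of_nat (m + (\<Sum>k\<in>{1..j}. a k)) powr (- z (int j))) *
       (\<Prod>i\<in>{1..q}. of_nat (m + (\<Sum>k\<in>{1..i}. b k)) powr (- z (- int i))))"
      unfolding tab_weight_def prod_hook
      using join_hook_arm[of 0 p q m a b] join_hook_arm[of _ p q m a b] join_hook_leg[of _ q p m a b]
      by (intro arg_cong2[where f = "(*)"] prod.cong) simp_all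
    then show ?thesis by (simp add: F_def A_def B_def)
  qed
  have "(tab_weight z (hook p q) has_sum ?H) (tableaux (hook p q))" by (rule has_sum_infsum[OF s])
  also have "?this \<longleftrightarrow> (F has_sum ?H) ?P"
  proof (rule has_sum_reindex_bij_witness[where i = "join_hook p q" and j = "split_hook p q"])
    fix M assume M: "M \<in> tableaux (hook p q)"
    show "join_hook p q (split_hook p q M) = M" by (rule join_split_hook[OF M])
    show "split_hook p q M \<in> ?P" by (rule split_hook_mem[OF M])
    show "F (split_hook p q M) = tab_weight z (hook p q) M"
      using weight[of "fst (split_hook p q M)" "fst (snd (split_hook p q M))" "snd (snd (split_hook p q M))"]
        join_split_hook[OF M] by simp
  qed (auto intro: join_hook_tableau split_join_hook)
  finally have F: "(F has_sum ?H) ?P" .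
  show ?thesis
  proof (rule has_sum_SigmaD[OF F])
    fix m :: nat assume m: "m \<in> {1..}"
    define c where "c = (of_nat m :: complex) powr (- z 0)"
    have c: "c \<noteq> 0" using m by (simp add: c_def)
    have nz: "complex_of_real (real m + real n) \<noteq> 0" for n
      unfolding of_real_eq_0_iff using m by (simp add: add_nonneg_eq_0_iff)
    have A0: "A m a \<noteq> 0" and B0: "B m b \<noteq> 0" for a b
      unfolding A_def B_def
      by (simp_all only: prod_zero_iff finite_atLeastAtMost powr_eq_0_iff nz) simp_all
    have "(\<lambda>y. F (m, y)) summable_on arm_funs p \<times> pos_funs {1..q}"
    proof (rule summable_on_SigmaD1[where A = "{1..}" and B = "\<lambda>_. arm_funs p \<times> pos_funs {1..q}"])
      show "(\<lambda>(x, y). F (x, y)) summable_on ?P"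
        using F by (simp add: summable_on_def) blast
    qed (rule m)
    then have "(\<lambda>y. c * (case y of (a, b) \<Rightarrow> A m a * B m b)) summable_on arm_funs p \<times> pos_funs {1..q}"
      by (simp add: F_def c_def case_prod_unfold)
    then have prod: "(\<lambda>(a, b). A m a * B m b) summable_on arm_funs p \<times> pos_funs {1..q}"
      using c by (simp add: summable_on_cmult_right')
    \<comment> \<open>Sample points for the slices; the factors \<open>A m\<close> and
      \<open>B m\<close> do not vanish there because all bases are positive.\<close>
    have "(\<lambda>_. 0) \<in> arm_funs p" "(\<lambda>k. if k \<in> {1..q} then 1 else 0) \<in> pos_funs {1..q}"
      by (auto simp: arm_funs_def pos_funs_def)
    then have "A m summable_on arm_funs p" "B m summable_on pos_funs {1..q}"
      using summable_on_product_fst[OF prod] summable_on_product_snd[OF prod] A0 B0 by blast+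
    moreover have "zeta_bullet_H p (\<lambda>j. z (int j)) (real m) = infsum (A m) (arm_funs p)"
      unfolding zeta_bullet_H_def arm_funs_def A_def ..
    moreover have "zeta_H q (\<lambda>l. z (- int l)) (real m) = infsum (B m) (pos_funs {1..q})"
      unfolding zeta_H_def pos_funs_def B_def ..
    ultimately have "((\<lambda>(a, b). A m a * B m b) has_sum
        (zeta_bullet_H p (\<lambda>j. z (int j)) (real m) * zeta_H q (\<lambda>l. z (- int l)) (real m)))
        (arm_funs p \<times> pos_funs {1..q})"
      by (intro has_sum_product) simp_all
    then have "((\<lambda>y. c * (case y of (a, b) \<Rightarrow> A m a * B m b)) has_sum hook_term z p q m)
        (arm_funs p \<times> pos_funs {1..q})"
      unfolding hook_term_def c_def by (rule has_sum_cmult_right)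
    then show "((\<lambda>y. F (m, y)) has_sum hook_term z p q m) (arm_funs p \<times> pos_funs {1..q})"
      by (simp add: F_def c_def case_prod_unfold)
  qed
qed

section \<open>Frobenius coordinates of a partition\<close>

lemma part_antimono:
  assumes "is_partition lam" "1 \<le> i" "i \<le> j"
  shows "part lam j \<le> part lam i"
proof (cases "j \<le> length lam")
  case True
  have "sorted_wrt (\<ge>) lam" using assms by (simp add: is_partition_def)
  then have "lam ! (j - 1) \<le> lam ! (i - 1)"
    using assms(2,3) True sorted_wrt_nth_less[of "(\<ge>)" lam "i - 1" "j - 1"] by (cases "i = j") auto
  then show ?thesis using assms True by (simp add: part_def)
qed (simp add: part_def)

text \<open>A nonempty finite down-closed set of positive integers is \<open>{1..m}\<close> with
  \<open>m\<close> its maximum. This turns the cardinalities defining \<open>durfee\<close> and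
  \<open>conj_part\<close> into inequalities.\<close>

lemma initial_segment_card:
  fixes S :: "nat set"
  assumes "finite S" "\<And>i. i \<in> S \<Longrightarrow> 1 \<le> i" and down: "\<And>i j. j \<in> S \<Longrightarrow> 1 \<le> i \<Longrightarrow> i \<le> j \<Longrightarrow> i \<in> S"
  shows "S = {1..card S}"
proof (cases "S = {}")
  case False
  define m where "m = Max S"
  have "m \<in> S" using assms False by (simp add: m_def)
  have "S \<subseteq> {1..m}" using assms(1,2) by (auto simp: m_def)
  moreover have "{1..m} \<subseteq> S"
  proof
    fix i assume "i \<in> {1..m}"
    then show "i \<in> S" by (intro down[OF \<open>m \<in> S\<close>]) auto
  qed
  ultimately have "S = {1..m}" by (rule equalityI)
  then show ?thesis by (metis card_atLeastAtMost diff_Suc_1)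
qed simp

lemma le_durfee_iff:
  assumes lam: "is_partition lam" and i: "1 \<le> i"
  shows "i \<le> durfee lam \<longleftrightarrow> i \<le> part lam i"
proof -
  let ?S = "{i \<in> {1..length lam}. i \<le> part lam i}"
  have "?S = {1..durfee lam}"
    unfolding durfee_def
  proof (rule initial_segment_card)
    show "k \<in> ?S" if "j \<in> ?S" "1 \<le> k" "k \<le> j" for k j
      using that part_antimono[OF lam that(2,3)] by auto
  qed auto
  moreover have "i \<le> part lam i \<Longrightarrow> i \<le> length lam" using i by (auto simp: part_def split: if_splits)
  ultimately show ?thesis using i by (metis (no_types, lifting) atLeastAtMost_iff mem_Collect_eq)
qed

text \<open>The duality of a partition and its conjugate; the set counted by
  \<open>conj_part\<close> is down-closed because the parts decrease weakly.\<close>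

lemma le_conj_part_iff:
  assumes lam: "is_partition lam" and ij: "1 \<le> i" "1 \<le> j"
  shows "i \<le> conj_part lam j \<longleftrightarrow> j \<le> part lam i"
proof -
  let ?S = "{i \<in> {1..length lam}. j \<le> part lam i}"
  have "?S = {1..conj_part lam j}"
    unfolding conj_part_def
  proof (rule initial_segment_card)
    show "k \<in> ?S" if "l \<in> ?S" "1 \<le> k" "k \<le> l" for k l
      using that part_antimono[OF lam that(2,3)] by auto
  qed auto
  moreover have "j \<le> part lam i \<Longrightarrow> i \<le> length lam" using ij by (auto simp: part_def split: if_splits)
  ultimately show ?thesis using ij by (metis (no_types, lifting) atLeastAtMost_iff mem_Collect_eq)
qed

text \<open>Up to the Durfee size \<open>j <= part lam j\<close>, so the subtraction is not
  truncated, and subtracting the index turns weak into strict decrease.\<close>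

lemma strict_dec_frob_p:
  assumes "is_partition lam"
  shows "strict_dec (durfee lam) (frob_p lam)"
  unfolding strict_dec_def frob_p_def
proof (intro allI impI)
  fix i j assume ij: "1 \<le> i \<and> i < j \<and> j \<le> durfee lam"
  then have "part lam j \<le> part lam i" "j \<le> part lam j"
    using part_antimono[OF assms, of i j] le_durfee_iff[OF assms, of j] by simp_all
  then show "part lam j - j < part lam i - i" using ij by arith
qed

lemma strict_dec_frob_q:
  assumes "is_partition lam"
  shows "strict_dec (durfee lam) (frob_q lam)"
  unfolding strict_dec_def frob_q_def
proof (intro allI impI)
  fix i j assume ij: "1 \<le> i \<and> i < j \<and> j \<le> durfee lam"
  then have j: "j \<le> conj_part lam j"
    using le_durfee_iff[OF assms, of j] le_conj_part_iff[OF assms, of j j] by simp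
  \<comment> \<open>Duality is applied twice at row \<open>conj_part lam j\<close>: it has at least
    \<open>j\<close>, hence at least \<open>i\<close> boxes, so column \<open>i\<close> reaches it
    too.\<close>
  then have "i \<le> part lam (conj_part lam j)"
    using ij le_conj_part_iff[OF assms, of "conj_part lam j" j] by simp
  then have "conj_part lam j \<le> conj_part lam i"
    using ij j le_conj_part_iff[OF assms, of "conj_part lam j" i] by simp
  then show "conj_part lam j - j < conj_part lam i - i" using ij j by arith
qed

text \<open>On and above the diagonal row lengths decide membership; below it, column lengths
  do.\<close>

lemma diagram_eq_frob_diagram:
  assumes lam: "is_partition lam"
  shows "diagram lam = frob_diagram (durfee lam) (frob_p lam) (frob_q lam)"
proof (rule set_eqI, clarify)
  fix i j
  have d: "(i, j) \<in> diagram lam \<longleftrightarrow> 1 \<le> i \<and> 1 \<le> j \<and> j \<le> part lam i"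
    by (auto simp: diagram_def part_def)
  have p: "i \<le> durfee lam \<longleftrightarrow> i \<le> part lam i" if "1 \<le> i" for i
    using le_durfee_iff[OF lam that] .
  have q: "i \<le> conj_part lam j \<longleftrightarrow> j \<le> part lam i" if "1 \<le> i" "1 \<le> j" for i j
    using le_conj_part_iff[OF lam that] .
  consider "i = 0 \<or> j = 0" | "1 \<le> i" "i \<le> j" | "1 \<le> j" "j < i" by linarith
  then show "(i, j) \<in> diagram lam \<longleftrightarrow> (i, j) \<in> frob_diagram (durfee lam) (frob_p lam) (frob_q lam)"
  proof cases
    case 1
    then show ?thesis by (auto simp: d frob_diagram_def)
  next
    case 2
    then have "(i, j) \<in> frob_diagram (durfee lam) (frob_p lam) (frob_q lam) \<longleftrightarrow>
        i \<le> durfee lam \<and> j \<le> i + frob_p lam i"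
      by (auto simp: frob_diagram_def)
    then show ?thesis using 2 p[of i] unfolding d frob_p_def by linarith
  next
    case 3
    then have f: "(i, j) \<in> frob_diagram (durfee lam) (frob_p lam) (frob_q lam) \<longleftrightarrow>
        j \<le> durfee lam \<and> i \<le> j + frob_q lam j"
      by (auto simp: frob_diagram_def)
    show ?thesis
    proof (cases "j \<le> durfee lam")
      case True
      then have "j \<le> conj_part lam j" using p[of j] q[of j j] 3 by blast
      then show ?thesis using 3 True q[of i j] unfolding f d frob_q_def by linarith
    next
      case False
      \<comment> \<open>A box below the diagonal in a column \<open>j\<close> beyond the Durfee size
        would give \<open>j <= part lam i <= part lam j < j\<close>.\<close>
      then have "part lam j < j" using p[of j] 3 by linarith
      then show ?thesis using 3 False part_antimono[OF lam, of j i] unfolding f d by linarith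
    qed
  qed
qed

section \<open>The determinant of hook sums as a single sum over \<open>m\<close>\<close>

lemma of_nat_mult_powr: "(of_nat (a * b) :: complex) powr s = of_nat a powr s * of_nat b powr s"
  using powr_times_real[of "of_nat a" "of_nat b" s] by simp

text \<open>Complex powers multiply here because the bases are nonnegative reals.\<close>

lemma of_nat_prod_powr:
  assumes "finite A"
  shows "(of_nat (\<Prod>i\<in>A. m i) :: complex) powr s = (\<Prod>i\<in>A. of_nat (m i) powr s)"
  using assms
  by (induction A rule: finite_induct) (simp_all add: of_nat_mult_powr del: of_nat_mult of_nat_prod)

lemma has_sum_finite_sum:
  fixes f :: "'a \<Rightarrow> 'b \<Rightarrow> 'c::topological_comm_monoid_add"
  assumes "finite I" "\<And>i. i \<in> I \<Longrightarrow> (f i has_sum S i) A"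
  shows "((\<lambda>x. \<Sum>i\<in>I. f i x) has_sum (\<Sum>i\<in>I. S i)) A"
  using assms by (induction I rule: finite_induct) (auto intro!: has_sum_add)

text \<open>For each \<open>\<sigma>\<close> the product of hook sums is one sum over all
  \<open>m\<close>. Naming the variables after columns puts \<open>m (\<sigma> k)\<close> into the
  arm factors, while the products of corner powers and of leg factors do not depend on
  \<open>\<sigma>\<close> and leave the sum over permutations.\<close>

lemma has_sum_hook_det:
  fixes z :: "int \<Rightarrow> complex" and H :: "nat \<Rightarrow> nat \<Rightarrow> complex"
  assumes H: "\<And>i j. i \<in> {1..N} \<Longrightarrow> j \<in> {1..N} \<Longrightarrow> (hook_term z (p i) (q j) has_sum H i j) {1..}"
  shows "((\<lambda>m. (of_nat (\<Prod>i\<in>{1..N}. m i)) powr (- z 0) *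
          (\<Sum>\<sigma>\<in>{\<sigma>. \<sigma> permutes {1..N}}. of_int (sign \<sigma>) *
             (\<Prod>k\<in>{1..N}. zeta_bullet_H (p k) (\<lambda>j. z (int j)) (real (m (\<sigma> k))))) *
          (\<Prod>j\<in>{1..N}. zeta_H (q j) (\<lambda>l. z (- int l)) (real (m j)))) has_sum detn N H) (pos_funs {1..N})"
proof -
  let ?Zb = "\<lambda>k m. zeta_bullet_H (p k) (\<lambda>j. z (int j)) (real m)"
  let ?Z = "\<lambda>j m. zeta_H (q j) (\<lambda>l. z (- int l)) (real m)"
  have perm: "((\<lambda>m. of_int (sign \<sigma>) * (\<Prod>k\<in>{1..N}. hook_term z (p k) (q (\<sigma> k)) (m (\<sigma> k)))) has_sum
      of_int (sign \<sigma>) * (\<Prod>k\<in>{1..N}. H k (\<sigma> k))) (pos_funs {1..N})"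
    if s: "\<sigma> permutes {1..N}" for \<sigma>
  proof -
    have inv: "inv \<sigma> j \<in> {1..N}" if "j \<in> {1..N}" for j
      using that permutes_in_image[OF permutes_inv[OF s]] by blast
    have reindex: "(\<Prod>k\<in>{1..N}. f k (\<sigma> k)) = (\<Prod>j\<in>{1..N}. f (inv \<sigma> j) j)"
      for f :: "nat \<Rightarrow> nat \<Rightarrow> complex"
      using prod.permute[OF s, of "\<lambda>j. f (inv \<sigma> j) j"] permutes_inverses(2)[OF s] by (simp add: o_def)
    have "((\<lambda>m. \<Prod>j\<in>{1..N}. hook_term z (p (inv \<sigma> j)) (q j) (m j)) has_sum
        (\<Prod>j\<in>{1..N}. H (inv \<sigma> j) j)) (pos_funs {1..N})"
      by (intro has_sum_prod_pos_funs H inv) simp_all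
    then show ?thesis
      unfolding reindex[where f = "\<lambda>k j. hook_term z (p k) (q j) (_ j)"] reindex
      by (rule has_sum_cmult_right)
  qed
  have total: "((\<lambda>m. \<Sum>\<sigma>\<in>{\<sigma>. \<sigma> permutes {1..N}}. of_int (sign \<sigma>) * (\<Prod>k\<in>{1..N}. hook_term z (p k) (q (\<sigma> k)) (m (\<sigma> k))))
      has_sum detn N H) (pos_funs {1..N})"
    unfolding detn_def 
  proof (rule has_sum_finite_sum)
    show "finite {\<sigma>. \<sigma> permutes {1..N}}" by (simp add: finite_permutations)
  qed (use perm in blast)
  have expand: "(\<Prod>k\<in>{1..N}. hook_term z (p k) (q (\<sigma> k)) (m (\<sigma> k))) =
      (of_nat (\<Prod>i\<in>{1..N}. m i)) powr (- z 0) * ((\<Prod>k\<in>{1..N}. ?Zb k (m (\<sigma> k))) * (\<Prod>j\<in>{1..N}. ?Z j (m j)))"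
    if s: "\<sigma> permutes {1..N}" for \<sigma> and m :: "nat \<Rightarrow> nat"
  proof -
    have "(\<Prod>k\<in>{1..N}. of_nat (m (\<sigma> k)) powr (- z 0)) = (\<Prod>k\<in>{1..N}. of_nat (m k) powr (- z 0))"
      using prod.permute[OF s, of "\<lambda>k. of_nat (m k) powr (- z 0)"] by (simp add: o_def)
    moreover have "(\<Prod>k\<in>{1..N}. ?Z (\<sigma> k) (m (\<sigma> k))) = (\<Prod>j\<in>{1..N}. ?Z j (m j))"
      using prod.permute[OF s, of "\<lambda>j. ?Z j (m j)"] by (simp add: o_def)
    ultimately show ?thesis
      unfolding hook_term_def prod.distrib of_nat_prod_powr[OF finite_atLeastAtMost] by simp
  qed
  have "(of_nat (\<Prod>i\<in>{1..N}. m i)) powr (- z 0) *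
      (\<Sum>\<sigma>\<in>{\<sigma>. \<sigma> permutes {1..N}}. of_int (sign \<sigma>) * (\<Prod>k\<in>{1..N}. ?Zb k (m (\<sigma> k)))) *
      (\<Prod>j\<in>{1..N}. ?Z j (m j)) =
    (\<Sum>\<sigma>\<in>{\<sigma>. \<sigma> permutes {1..N}}. of_int (sign \<sigma>) * (\<Prod>k\<in>{1..N}. hook_term z (p k) (q (\<sigma> k)) (m (\<sigma> k))))"
    for m :: "nat \<Rightarrow> nat"
    unfolding sum_distrib_left sum_distrib_right
    by (intro sum.cong refl) (simp only: expand mem_Collect_eq mult_ac)
  then show ?thesis using total by (simp only:)
qed

lemma schur_term_eq_tab_weight:
  "schur_term lam (\<lambda>(i, j). z (int j - int i)) = tab_weight z (diagram lam)"
  by (rule ext) (simp add: schur_term_def tab_weight_def content_def case_prod_unfold)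

text \<open>Summability is asserted along with the identity, since \<open>infsum\<close> returns 0
  on families that are not summable.\<close>

theorem theorem4p3:
  fixes lam :: "nat list" and z :: "int \<Rightarrow> complex"
  assumes part: "is_partition lam"
    and z_ge: "\<forall>(i, j)\<in>diagram lam. 1 \<le> Re (z (int j - int i))"
    and z_p: "\<forall>i\<in>{1..durfee lam}. 1 < Re (z (int (frob_p lam i)))"
    and z_q: "\<forall>i\<in>{1..durfee lam}. 1 < Re (z (- int (frob_q lam i)))"
  shows "schur_term lam (\<lambda>(i, j). z (int j - int i)) summable_on SSYT lam
    \<and> schur_zeta lam (\<lambda>(i, j). z (int j - int i)) =
      infsum (\<lambda>m. (of_nat (\<Prod>i\<in>{1..durfee lam}. m i)) powr (- z 0) *
          (\<Sum>\<sigma>\<in>{\<sigma>. \<sigma> permutes {1..durfee lam}}. of_int (sign \<sigma>) *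
             (\<Prod>k\<in>{1..durfee lam}.
                zeta_bullet_H (frob_p lam k) (\<lambda>j. z (int j)) (real (m (\<sigma> k))))) *
          (\<Prod>j\<in>{1..durfee lam}.
                zeta_H (frob_q lam j) (\<lambda>l. z (- int l)) (real (m j))))
        {m :: nat \<Rightarrow> nat. (\<forall>i\<in>{1..durfee lam}. 1 \<le> m i) \<and> (\<forall>i. i \<notin> {1..durfee lam} \<longrightarrow> m i = 0)}"
proof
  let ?N = "durfee lam" and ?p = "frob_p lam" and ?q = "frob_q lam"
  note p = strict_dec_frob_p[OF part] and q = strict_dec_frob_q[OF part]
  note D = diagram_eq_frob_diagram[OF part]
  have ge: "1 \<le> Re (z (content b))" if "b \<in> frob_diagram ?N ?p ?q" for b
    using z_ge that unfolding D content_def by (cases b) auto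
  have gt: "1 < Re (z (int (?p i))) \<and> 1 < Re (z (- int (?q i)))" if "i \<in> {1..?N}" for i
    using z_p z_q that by blast
  show "schur_term lam (\<lambda>(i, j). z (int j - int i)) summable_on SSYT lam"
    unfolding schur_term_eq_tab_weight SSYT_eq_tableaux D
    by (rule tab_weight_frob_summable[OF p q ge gt])
  have hook: "(hook_term z (?p i) (?q j) has_sum
      infsum (tab_weight z (hook (?p i) (?q j))) (tableaux (hook (?p i) (?q j)))) {1..}"
    if ij: "i \<in> {1..?N}" "j \<in> {1..?N}" for i j
  \<comment> \<open>A hook is the case \<open>N = 1\<close> of a Frobenius diagram, so the same
    convergence criterion applies.\<close>
  proof (rule hook_has_sum, rule tab_weight_frob_summable)
    show "1 \<le> Re (z (content b))" if "b \<in> hook (?p i) (?q j)" for b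
      using ge ij that by (rule hook_content_ge[of ?N ?p ?q z i j b])
  qed (use gt[OF ij(1)] gt[OF ij(2)] in auto)
  have "schur_zeta lam (\<lambda>(i, j). z (int j - int i)) =
    detn ?N (\<lambda>i j. infsum (tab_weight z (hook (?p i) (?q j))) (tableaux (hook (?p i) (?q j))))"
    unfolding schur_zeta_def schur_term_eq_tab_weight SSYT_eq_tableaux D
    by (rule giambelli_infsum[OF p q ge gt])
  then show "schur_zeta lam (\<lambda>(i, j). z (int j - int i)) =
      infsum (\<lambda>m. (of_nat (\<Prod>i\<in>{1..durfee lam}. m i)) powr (- z 0) *
          (\<Sum>\<sigma>\<in>{\<sigma>. \<sigma> permutes {1..durfee lam}}. of_int (sign \<sigma>) *
             (\<Prod>k\<in>{1..durfee lam}.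
                zeta_bullet_H (frob_p lam k) (\<lambda>j. z (int j)) (real (m (\<sigma> k))))) *
          (\<Prod>j\<in>{1..durfee lam}.
                zeta_H (frob_q lam j) (\<lambda>l. z (- int l)) (real (m j))))
        {m :: nat \<Rightarrow> nat. (\<forall>i\<in>{1..durfee lam}. 1 \<le> m i) \<and> (\<forall>i. i \<notin> {1..durfee lam} \<longrightarrow> m i = 0)}"
    using infsumI[OF has_sum_hook_det[OF hook]] unfolding pos_funs_def by simp
qed

end
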